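(* Let $(\Omega,\Sigma,\mu)$ and $(\Omega,\Sigma,\nu)$ be two $\sigma$-finite measure spaces, let $p,q\in[1,+\infty]$, and let $g\in L_0(\Omega,\mu)$ be such that the multiplication operator $M_g:L_p(\Omega,\mu)\to L_q(\Omega,\nu)$, $f\mapsto g\cdot f$, is a well-defined bounded operator. Let $\mu=\rho_{\mu,\nu}\cdot\nu+\mu_s$ be the Lebesgue decomposition of $\mu$ with respect to $\nu$, with $\Omega=\Omega_c\sqcup\Omega_s$ and $\nu(\Omega_s)=\mu_s(\Omega_c)=0$. Then the following are equivalent: i) $M_g\in\mathcal{B}(L_p(\Omega,\mu),L_q(\Omega,\nu))$ is coisometric; ii) $M_g^{\Omega_c}:L_p(\Omega_c,\mu|_{\Omega_c})\to L_q(\Omega_c,\nu|_{\Omega_c})$ is an isometric isomorphism; iii) $\rho_{\mu,\nu}$ is positive, $|g\cdot\rho_{\mu,\nu}^{-1/p}|_{\Omega_c}|=\mu(\Omega_c)^{1/p-1/q}$, and if $p\neq q$ the space $(\Omega,\Sigma,\mu)$ consists of a single atom.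
   Context: All linear spaces are over $\mathbb{C}$; measures are nonnegative, $\sigma$-additive, with values in $[0,+\infty]$. $\mathcal{B}(X,Y)$ is the space of bounded linear operators from $X$ to $Y$. $L_0(\Omega,\mu)$ is the space of measurable complex functions on $\Omega$. If $p=\infty$ then $1/p=0$. For $p=q$ the quantity $\mu(\Omega_c)^{1/p-1/q}$ means $1$. Equalities and inequalities between functions (including positivity) are understood up to sets of measure zero. For a nonnegative measurable $\rho$, $(\rho\cdot\nu)(E)=\int_E\rho\,d\nu$. Lebesgue decomposition of $\mu$ with respect to $\nu$: a nonnegative measurable function $\rho_{\mu,\nu}$, a $\sigma$-finite measure $\mu_s$ and a set $\Omega_s\in\Sigma$ such that $\mu=\rho_{\mu,\nu}\cdot\nu+\mu_s$ and $\nu(\Omega_s)=\mu_s(\Omega_c)=0$, where $\Omega_c=\Omega\setminus\Omega_s$. For $E\in\Sigma$, $M_g^E:L_p(E,\mu|_E)\to L_q(E,\nu|_E)$ is the operator $f\mapsto g|_E\cdot f$. In (iii), $|g\cdot\rho_{\mu,\nu}^{-1/p}|_{\Omega_c}|$ denotes the absolute value of the restriction of $g\cdot\rho_{\mu,\nu}^{-1/p}$ to $\Omega_c$. An operator $T:X\to Y$ between normed spaces is coisometric if it is contractive ($\|T\|\leq1$) and for every $c'>1$ and $y\in Y$ there is $x\in X$ with $T(x)=y$ and $\|x\|<c'\|y\|$ (for $y=0$ one takes $x=0$). An isometric isomorphism is a surjective linear isometry. An atom of $(\Omega,\Sigma,\mu)$ is a set $\Omega'\in\Sigma$ with $\mu(\Omega')>0$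 such that for every $E\in\Sigma$ with $E\subset\Omega'$ either $\mu(E)=0$ or $\mu(\Omega'\setminus E)=0$. "Consists of a single atom" means that $\Omega$ itself is an atom.
   Formalization: In (iii), for p≠q, the constant μ(Ω_c)^{1/p-1/q} is corrected to ν(Ω_c)^{1/p-1/q}, the single atom is (Ω_c, μ|Ω_c) rather than (Ω, μ), and the atom condition is required only if ν(Ω)≠0; as printed the equivalence fails in simple examples. *)

theory Defs
  imports "HOL-Analysis.Analysis" "HOL-Probability.Essential_Supremum"
begin

section \<open>Normed spaces given by a carrier, and operators between them\<close>

text \<open>
  The spaces \<open>L_p(\<Omega>,\<mu>)\<close> depend on the measure \<open>\<mu>\<close>, which is a term, so they cannot be types.
\<close>

record 'v nspace =
  vecs :: "'v set"
  vzero :: 'v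
  vadd :: "'v \<Rightarrow> 'v \<Rightarrow> 'v"
  vsmult :: "complex \<Rightarrow> 'v \<Rightarrow> 'v"
  vnorm :: "'v \<Rightarrow> real"

definition linear_operator :: "'v nspace \<Rightarrow> 'w nspace \<Rightarrow> ('v \<Rightarrow> 'w) \<Rightarrow> bool" where
  "linear_operator X Y T \<longleftrightarrow>
     (\<forall>x\<in>vecs X. T x \<in> vecs Y) \<and>
     (\<forall>x\<in>vecs X. \<forall>x'\<in>vecs X. T (vadd X x x') = vadd Y (T x) (T x')) \<and>
     (\<forall>c. \<forall>x\<in>vecs X. T (vsmult X c x) = vsmult Y c (T x))"

definition bounded_operator :: "'v nspace \<Rightarrow> 'w nspace \<Rightarrow> ('v \<Rightarrow> 'w) \<Rightarrow> bool" where
  "bounded_operator X Y T \<longleftrightarrow>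
     linear_operator X Y T \<and> (\<exists>K. \<forall>x\<in>vecs X. vnorm Y (T x) \<le> K * vnorm X x)"

definition contractive :: "'v nspace \<Rightarrow> 'w nspace \<Rightarrow> ('v \<Rightarrow> 'w) \<Rightarrow> bool" where
  "contractive X Y T \<longleftrightarrow>
     linear_operator X Y T \<and> (\<forall>x\<in>vecs X. vnorm Y (T x) \<le> vnorm X x)"

definition coisometric :: "'v nspace \<Rightarrow> 'w nspace \<Rightarrow> ('v \<Rightarrow> 'w) \<Rightarrow> bool" where
  "coisometric X Y T \<longleftrightarrow>
     contractive X Y T \<and>
     (\<forall>c'>1. \<forall>y\<in>vecs Y. \<exists>x\<in>vecs X. T x = y \<and>
        (if y = vzero Y then x = vzero X else vnorm X x < c' * vnorm Y y))"

definition isometric_isomorphism :: "'v nspace \<Rightarrow> 'w nspace \<Rightarrow> ('v \<Rightarrow> 'w) \<Rightarrow> bool" where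
  "isometric_isomorphism X Y T \<longleftrightarrow>
     linear_operator X Y T \<and>
     (\<forall>x\<in>vecs X. vnorm Y (T x) = vnorm X x) \<and>
     T ` vecs X = vecs Y"

section \<open>The spaces \<open>L_p(\<Omega>,\<mu>)\<close>\<close>

text \<open>The real number \<open>1/p\<close>, which is \<open>0\<close> for \<open>p = \<infinity>\<close>.\<close>

definition recip :: "ennreal \<Rightarrow> real" where
  "recip p = enn2real (1 / p)"

definition Lp_fun :: "ennreal \<Rightarrow> 'a measure \<Rightarrow> ('a \<Rightarrow> complex) set" where
  "Lp_fun p M =
     (if p = \<infinity>
      then {f \<in> borel_measurable M. esssup M (\<lambda>x. ennreal (cmod (f x))) < \<infinity>}
      else {f \<in> borel_measurable M. integrable M (\<lambda>x. cmod (f x) powr enn2real p)})"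

definition Lp_seminorm :: "ennreal \<Rightarrow> 'a measure \<Rightarrow> ('a \<Rightarrow> complex) \<Rightarrow> real" where
  "Lp_seminorm p M f =
     (if p = \<infinity>
      then enn2real (esssup M (\<lambda>x. ennreal (cmod (f x))))
      else (\<integral>x. cmod (f x) powr enn2real p \<partial>M) powr recip p)"

definition ae_rel :: "ennreal \<Rightarrow> 'a measure \<Rightarrow> (('a \<Rightarrow> complex) \<times> ('a \<Rightarrow> complex)) set" where
  "ae_rel p M = {(f, h). f \<in> Lp_fun p M \<and> h \<in> Lp_fun p M \<and> (AE x in M. f x = h x)}"

text \<open>
  The vectors are the classes of functions modulo equality almost everywhere. The unions below
  lift the pointwise operations to classes, and \<open>the_elem\<close> extracts the common seminorm of the
  members of a class.
\<close>

definition Lp :: "ennreal \<Rightarrow> 'a measure \<Rightarrow> ('a \<Rightarrow> complex) set nspace" where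
  "Lp p M =
     \<lparr> vecs = Lp_fun p M // ae_rel p M,
       vzero = ae_rel p M `` {\<lambda>_. 0},
       vadd = (\<lambda>F H. \<Union>f\<in>F. \<Union>h\<in>H. ae_rel p M `` {\<lambda>x. f x + h x}),
       vsmult = (\<lambda>c F. \<Union>f\<in>F. ae_rel p M `` {\<lambda>x. c * f x}),
       vnorm = (\<lambda>F. the_elem (Lp_seminorm p M ` F)) \<rparr>"

section \<open>Multiplication operators\<close>

definition mult_well_defined ::
    "ennreal \<Rightarrow> 'a measure \<Rightarrow> ennreal \<Rightarrow> 'a measure \<Rightarrow> ('a \<Rightarrow> complex) \<Rightarrow> bool" where
  "mult_well_defined p M q N g \<longleftrightarrow>
     (\<forall>f\<in>Lp_fun p M. (\<lambda>x. g x * f x) \<in> Lp_fun q N) \<and>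
     (\<forall>f\<in>Lp_fun p M. \<forall>f'\<in>Lp_fun p M.
        (AE x in M. f x = f' x) \<longrightarrow> (AE x in N. g x * f x = g x * f' x))"

text \<open>The class of \<open>f\<close> is sent to the class of \<open>g \<cdot> f\<close> in \<open>L_q(\<Omega>,\<nu>)\<close>.\<close>

definition mult_op ::
    "ennreal \<Rightarrow> 'a measure \<Rightarrow> ('a \<Rightarrow> complex) \<Rightarrow> ('a \<Rightarrow> complex) set \<Rightarrow> ('a \<Rightarrow> complex) set" where
  "mult_op q N g F = (\<Union>f\<in>F. ae_rel q N `` {\<lambda>x. g x * f x})"

section \<open>Lebesgue decomposition and atoms\<close>

definition lebesgue_decomposition ::
    "'a measure \<Rightarrow> 'a measure \<Rightarrow> ('a \<Rightarrow> real) \<Rightarrow> 'a measure \<Rightarrow> 'a set \<Rightarrow> bool" where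
  "lebesgue_decomposition M N \<rho> Ms \<Omega>s \<longleftrightarrow>
     \<rho> \<in> borel_measurable N \<and> (AE x in N. 0 \<le> \<rho> x) \<and>
     sigma_finite_measure Ms \<and> sets Ms = sets M \<and>
     (\<forall>E\<in>sets M. emeasure M E = emeasure (density N (\<lambda>x. ennreal (\<rho> x))) E + emeasure Ms E) \<and>
     \<Omega>s \<in> sets M \<and> emeasure N \<Omega>s = 0 \<and> emeasure Ms (space M - \<Omega>s) = 0"

definition is_atom :: "'a measure \<Rightarrow> 'a set \<Rightarrow> bool" where
  "is_atom M A \<longleftrightarrow>
     A \<in> sets M \<and> emeasure M A > 0 \<and>
     (\<forall>E\<in>sets M. E \<subseteq> A \<longrightarrow> emeasure M E = 0 \<or> emeasure M (A - E) = 0)"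

definition single_atom_space :: "'a measure \<Rightarrow> bool" where
  "single_atom_space M \<longleftrightarrow> is_atom M (space M)"

end

theory Submission
  imports Defs
begin

text \<open>
  Since \<open>\<nu>\<close> vanishes on \<open>\<Omega>s\<close>, the operator does not see the singular part of \<open>\<mu>\<close>: it is the
  projection of \<open>L_p(\<Omega>, \<mu>)\<close> onto \<open>L_p(\<Omega>c, \<mu>)\<close> followed by multiplication on \<open>\<Omega>c\<close>, where \<open>\<mu>\<close> has the
  density \<open>\<rho>\<close> with respect to \<open>\<nu>\<close>. Projections of this kind are coisometric, so everything is
  decided on \<open>\<Omega>c\<close>. If the operator is onto, then \<open>g\<close> is nonzero almost everywhere, hence
  multiplication on \<open>\<Omega>c\<close> is injective, and an injective coisometry is an isometry onto. This is
  \<open>coisometric_iff_restriction_isometric\<close>.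

  On \<open>\<Omega>c\<close> an isometry onto forces \<open>\<rho> > 0\<close>, because functions supported in \<open>{\<rho> = 0}\<close> are zero in
  \<open>L_p(\<mu>)\<close> while \<open>g\<close> does not vanish there. For \<open>p = q < \<infinity>\<close> the isometry identity on sets \<open>E\<close> of finite measure reads
  \<open>\<integral>\<^sub>E |g|\<^sup>p d\<nu> = \<integral>\<^sub>E \<rho> d\<nu>\<close>, so \<open>|g|\<^sup>p = \<rho>\<close>; for \<open>p = q = \<infinity>\<close> both \<open>g\<close> and \<open>1/g\<close> have norm at most \<open>1\<close>.
  For \<open>p \<noteq> q\<close> two disjointly supported unit vectors cannot exist, since their sum has norm \<open>2\<close> to
  the power \<open>1/p\<close> in the source and \<open>2\<close> to the power \<open>1/q\<close> in the target
  (\<open>Lp_seminorm_add_disjoint\<close>); so \<open>\<Omega>c\<close> is an atom, all functions on it are constant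
  (\<open>single_atom_space_AE_const\<close>), and \<open>|g|\<close> is found by comparing the norms of \<open>1\<close> and \<open>g\<close>. Conversely the
  stated values of \<open>|g|\<close> make the norms of \<open>f\<close> and \<open>g \<cdot> f\<close> equal, and division by \<open>g\<close> is the
  inverse. These equivalences form \<open>isometric_surjective_iff\<close>.
\<close>

section \<open>The seminorm of \<open>L_p\<close> through an extended real gauge\<close>

text \<open>
  The \<open>p\<close>-th power of the norm for finite \<open>p\<close>, and the norm itself for \<open>p = \<infinity>\<close>. Its values lie in
  \<open>[0, \<infinity>]\<close>, so for measurable \<open>f\<close> its finiteness decides membership in \<open>L_p\<close> and its value determines the seminorm:
  one equation between gauges transfers both at once.
\<close>
definition Lp_gauge :: "ennreal \<Rightarrow> 'a measure \<Rightarrow> ('a \<Rightarrow> complex) \<Rightarrow> ennreal" where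
  "Lp_gauge p M f =
     (if p = \<infinity> then esssup M (\<lambda>x. ennreal (cmod (f x)))
      else (\<integral>\<^sup>+x. ennreal (cmod (f x) powr enn2real p) \<partial>M))"

lemma Lp_fun_iff_gauge:
  "f \<in> Lp_fun p M \<longleftrightarrow> f \<in> borel_measurable M \<and> Lp_gauge p M f < \<infinity>"
  by (auto simp: Lp_fun_def Lp_gauge_def integrable_iff_bounded)

lemma Lp_fun_measurable [measurable_dest]: "f \<in> Lp_fun p M \<Longrightarrow> f \<in> borel_measurable M"
  by (simp add: Lp_fun_iff_gauge)

lemma Lp_seminorm_eq_gauge:
  assumes "f \<in> borel_measurable M"
  shows "Lp_seminorm p M f = enn2real (Lp_gauge p M f) powr (if p = \<infinity> then 1 else recip p)"
  using assms
  by (auto simp: Lp_seminorm_def Lp_gauge_def integral_eq_nn_integral)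

lemma Lp_seminorm_nonneg: "0 \<le> Lp_seminorm p M f"
  by (auto simp: Lp_seminorm_def)

lemma enn2real_exponent_ge_1: "1 \<le> p \<Longrightarrow> p \<noteq> \<infinity> \<Longrightarrow> 1 \<le> enn2real p"
  by (cases p) auto

lemma recip_eq_inverse: "1 \<le> p \<Longrightarrow> p \<noteq> \<infinity> \<Longrightarrow> recip p = 1 / enn2real p"
  by (cases p) (auto simp: recip_def divide_ennreal ennreal_1[symmetric] simp del: ennreal_1)

lemma recip_infinity [simp]: "recip \<infinity> = 0"  "recip top = 0"
  by (auto simp: recip_def)

lemma recip_pos: "1 \<le> p \<Longrightarrow> p \<noteq> \<infinity> \<Longrightarrow> 0 < recip p"
  using enn2real_exponent_ge_1[of p] by (simp add: recip_eq_inverse)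

lemma recip_nonneg: "0 \<le> recip p"
  by (simp add: recip_def)

lemma recip_inject:
  assumes "1 \<le> p" "1 \<le> q"
  shows "recip p = recip q \<longleftrightarrow> p = q"
proof (cases "p = \<infinity> \<or> q = \<infinity>")
  case True
  then show ?thesis using recip_pos[of p] recip_pos[of q] assms by fastforce
next
  case False
  then have "recip p = recip q \<longleftrightarrow> enn2real p = enn2real q"
    using assms by (simp add: recip_eq_inverse divide_simps) (metis assms enn2real_exponent_ge_1 not_one_le_zero)
  also have "\<dots> \<longleftrightarrow> p = q"
    using False by (metis ennreal_enn2real_if infinity_ennreal_def)
  finally show ?thesis .
qed

lemma Lp_gauge_mono_AE:
  assumes "f \<in> borel_measurable M" "AE x in M. cmod (f x) \<le> cmod (k x)" "1 \<le> p"
  shows "Lp_gauge p M f \<le> Lp_gauge p M k"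
proof (cases "p = \<infinity>")
  case True
  then show ?thesis using assms unfolding Lp_gauge_def
    by (auto intro!: esssup_AE_mono ennreal_leI elim!: eventually_mono)
next
  case False
  then show ?thesis using assms enn2real_exponent_ge_1[of p] unfolding Lp_gauge_def
    by (auto intro!: nn_integral_mono_AE ennreal_leI powr_mono2 elim!: eventually_mono)
qed

lemma Lp_gauge_cong_AE:
  assumes "f \<in> borel_measurable M" "k \<in> borel_measurable M"
    and "AE x in M. cmod (f x) = cmod (k x)" "1 \<le> p"
  shows "Lp_gauge p M f = Lp_gauge p M k"
  using assms
  by (intro antisym Lp_gauge_mono_AE) (auto elim!: eventually_mono)

lemma Lp_seminorm_mono_AE:
  assumes "f \<in> borel_measurable M" "k \<in> Lp_fun p M" "1 \<le> p"
    and "AE x in M. cmod (f x) \<le> cmod (k x)"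
  shows "Lp_seminorm p M f \<le> Lp_seminorm p M k"
proof -
  have "enn2real (Lp_gauge p M f) \<le> enn2real (Lp_gauge p M k)"
    using Lp_gauge_mono_AE[of f M k p] assms by (auto intro!: enn2real_mono simp: Lp_fun_iff_gauge)
  then show ?thesis
    using assms by (auto simp: Lp_seminorm_eq_gauge Lp_fun_iff_gauge intro!: powr_mono2 recip_nonneg)
qed

lemma Lp_seminorm_cong_AE:
  assumes "f \<in> borel_measurable M" "k \<in> borel_measurable M"
    and "AE x in M. cmod (f x) = cmod (k x)" "1 \<le> p"
  shows "Lp_seminorm p M f = Lp_seminorm p M k"
  using Lp_gauge_cong_AE[OF assms] assms by (simp add: Lp_seminorm_eq_gauge)

lemma Lp_fun_mono_AE:
  assumes "f \<in> borel_measurable M" "k \<in> Lp_fun p M" "1 \<le> p"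
    and "AE x in M. cmod (f x) \<le> cmod (k x)"
  shows "f \<in> Lp_fun p M"
  using Lp_gauge_mono_AE[of f M k p] assms by (auto simp: Lp_fun_iff_gauge)

lemma Lp_seminorm_eq_0_iff:
  assumes f: "f \<in> Lp_fun p M" and p: "1 \<le> p"
  shows "Lp_seminorm p M f = 0 \<longleftrightarrow> (AE x in M. f x = 0)"
proof -
  have [measurable]: "f \<in> borel_measurable M" and fin: "Lp_gauge p M f < \<infinity>"
    using f by (auto simp: Lp_fun_iff_gauge)
  have "Lp_seminorm p M f = 0 \<longleftrightarrow> Lp_gauge p M f = 0"
    using fin by (auto simp: Lp_seminorm_eq_gauge enn2real_eq_0_iff)
  also have "\<dots> \<longleftrightarrow> (AE x in M. f x = 0)"
  proof (cases "p = \<infinity>")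
    case True
    have "(AE x in M. f x = 0)" if "esssup M (\<lambda>x. ennreal (cmod (f x))) = 0"
      using esssup_AE[where M=M and f="\<lambda>x. ennreal (cmod (f x))"] that
      by (auto elim!: eventually_mono)
    moreover have "esssup M (\<lambda>x. ennreal (cmod (f x))) \<le> 0" if "AE x in M. f x = 0"
      using that by (intro esssup_I) (auto elim!: eventually_mono)
    ultimately show ?thesis using True by (auto simp: Lp_gauge_def)
  next
    case False
    then show ?thesis
      by (auto simp: Lp_gauge_def nn_integral_0_iff_AE)
  qed
  finally show ?thesis .
qed

lemma Lp_gauge_restrict_space:
  assumes A: "A \<in> sets M" and f: "f \<in> borel_measurable (restrict_space M A)" and p: "1 \<le> p"
  shows "Lp_gauge p (restrict_space M A) f = Lp_gauge p M (\<lambda>x. indicator A x * f x)"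
proof -
  have A': "A \<inter> space M \<in> sets M" using A by auto
  have [measurable]: "(\<lambda>x. indicator A x * f x) \<in> borel_measurable M"
    using f borel_measurable_restrict_space_iff[OF A', of f]
    by (simp add: scaleR_conv_of_real of_real_indicator)
  show ?thesis
  proof (cases "p = \<infinity>")
    case True
    have "(AE x in restrict_space M A. ennreal (cmod (f x)) \<le> z) \<longleftrightarrow>
      (AE x in M. ennreal (cmod (indicator A x * f x)) \<le> z)" for z
      unfolding AE_restrict_space_iff[OF A']
      by (rule AE_cong) (auto simp: indicator_def)
    then show ?thesis using True f by (simp add: Lp_gauge_def esssup_eq_AE)
  next
    case False
    have "cmod (indicator A x * f x) powr enn2real p = indicator A x * cmod (f x) powr enn2real p" for x
      using enn2real_exponent_ge_1[OF p False] by (auto simp: indicator_def)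
    then show ?thesis using False
      by (simp add: Lp_gauge_def nn_integral_restrict_space[OF A'] ennreal_mult' ennreal_indicator mult.commute)
  qed
qed

lemma Lp_fun_restrict_space_iff:
  assumes A: "A \<in> sets M" and p: "1 \<le> p"
  shows "f \<in> Lp_fun p (restrict_space M A) \<longleftrightarrow> (\<lambda>x. indicator A x * f x) \<in> Lp_fun p M"
proof -
  have A': "A \<inter> space M \<in> sets M" using A by auto
  show ?thesis
    using borel_measurable_restrict_space_iff[OF A', of f] Lp_gauge_restrict_space[OF A _ p, of f]
    by (auto simp: Lp_fun_iff_gauge scaleR_conv_of_real of_real_indicator)
qed

lemma Lp_seminorm_restrict_space:
  assumes A: "A \<in> sets M" and p: "1 \<le> p" and f: "f \<in> Lp_fun p (restrict_space M A)"
  shows "Lp_seminorm p (restrict_space M A) f = Lp_seminorm p M (\<lambda>x. indicator A x * f x)"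
  using assms Lp_fun_restrict_space_iff[OF A p, of f]
  by (simp add: Lp_seminorm_eq_gauge Lp_gauge_restrict_space Lp_fun_measurable)

text \<open>
  Passing from \<open>\<rho> \<cdot> N\<close> to \<open>N\<close> multiplies the integrand \<open>|f|\<^sup>p\<close> by \<open>\<rho>\<close>, which amounts to multiplying
  \<open>|f|\<close> by \<open>\<rho>\<close> to the power \<open>1/p\<close>. For \<open>p = \<infinity>\<close> that power is \<open>1\<close> and the gauge depends only
  on the null sets, which agree because \<open>\<rho>\<close> is positive.
\<close>
lemma Lp_gauge_density_AE:
  assumes [measurable]: "f \<in> borel_measurable N" "k \<in> borel_measurable N" "\<rho> \<in> borel_measurable N"
    and pos: "AE x in N. 0 < \<rho> x" and p: "1 \<le> p"
    and eq: "AE x in N. cmod (k x) = cmod (f x) * \<rho> x powr recip p"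
  shows "Lp_gauge p (density N (\<lambda>x. ennreal (\<rho> x))) f = Lp_gauge p N k"
proof (cases "p = \<infinity>")
  case True
  have *: "AE x in N. (0 < ennreal (\<rho> x) \<longrightarrow> ennreal (cmod (f x)) \<le> z) \<longleftrightarrow> ennreal (cmod (k x)) \<le> z" for z
    using pos eq by eventually_elim (use True in auto)
  have "(AE x in density N (\<lambda>x. ennreal (\<rho> x)). ennreal (cmod (f x)) \<le> z) \<longleftrightarrow>
      (AE x in N. ennreal (cmod (k x)) \<le> z)" for z
    using eventually_subst[OF *[of z]] by (simp add: AE_density)
  then show ?thesis using True by (simp add: Lp_gauge_def esssup_eq_AE)
next
  case False
  have "(\<integral>\<^sup>+x. ennreal (\<rho> x) * ennreal (cmod (f x) powr enn2real p) \<partial>N) = (\<integral>\<^sup>+x. ennreal (cmod (k x) powr enn2real p) \<partial>N)"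
  proof (rule nn_integral_cong_AE)
    show "AE x in N. ennreal (\<rho> x) * ennreal (cmod (f x) powr enn2real p) = ennreal (cmod (k x) powr enn2real p)"
      using pos eq
    proof eventually_elim
      case (elim x)
      have "recip p * enn2real p = 1"
        using enn2real_exponent_ge_1[OF p False] recip_eq_inverse[OF p False] by simp
      with elim have "cmod (k x) powr enn2real p = cmod (f x) powr enn2real p * \<rho> x"
        by (simp add: powr_mult powr_powr)
      then show ?case using elim by (simp add: ennreal_mult[symmetric] mult.commute)
    qed
  qed
  then show ?thesis using False by (simp add: Lp_gauge_def nn_integral_density)
qed

text \<open>
  For \<open>p = \<infinity>\<close> only \<open>\<le>\<close> is evident from the definition of the essential supremum; the converse is
  the same inequality for the scalar \<open>inverse c\<close> and the function \<open>c \<cdot> f\<close>.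
\<close>
lemma Lp_fun_cmult:
  assumes f: "f \<in> Lp_fun p M" and p: "1 \<le> p"
  shows "(\<lambda>x. c * f x) \<in> Lp_fun p M \<and> Lp_seminorm p M (\<lambda>x. c * f x) = cmod c * Lp_seminorm p M f"
proof (cases "p = \<infinity>")
  case True
  have [measurable]: "f \<in> borel_measurable M" using f by (auto simp: Lp_fun_iff_gauge)
  have le: "esssup M (\<lambda>x. ennreal (cmod (c * k x))) \<le> ennreal (cmod c) * esssup M (\<lambda>x. ennreal (cmod (k x)))"
    if [measurable]: "k \<in> borel_measurable M" for c k
  proof (rule esssup_I)
    show "AE x in M. ennreal (cmod (c * k x)) \<le> ennreal (cmod c) * esssup M (\<lambda>x. ennreal (cmod (k x)))"
      using esssup_AE[where M=M and f="\<lambda>x. ennreal (cmod (k x))"]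
      by eventually_elim (auto simp: norm_mult ennreal_mult intro: mult_left_mono)
  qed simp
  have "esssup M (\<lambda>x. ennreal (cmod (c * f x))) = ennreal (cmod c) * esssup M (\<lambda>x. ennreal (cmod (f x)))"
  proof (cases "c = 0")
    case True
    with le[of f c] show ?thesis by simp
  next
    case False
    have "ennreal (cmod c) * esssup M (\<lambda>x. ennreal (cmod (f x)))
       = ennreal (cmod c) * esssup M (\<lambda>x. ennreal (cmod (inverse c * (c * f x))))"
      using False by (simp add: mult.assoc[symmetric])
    also have "\<dots> \<le> ennreal (cmod c) * (ennreal (cmod (inverse c)) * esssup M (\<lambda>x. ennreal (cmod (c * f x))))"
      by (intro mult_left_mono le) auto
    also have "\<dots> = esssup M (\<lambda>x. ennreal (cmod (c * f x)))"
      using False by (simp add: mult.assoc[symmetric] ennreal_mult[symmetric] norm_inverse)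
    finally show ?thesis using le[of f c] by (intro antisym) auto
  qed
  with True f show ?thesis
    by (auto simp: Lp_fun_def Lp_seminorm_def enn2real_mult ennreal_mult_less_top)
next
  case False
  with f show ?thesis
    using p enn2real_exponent_ge_1[OF p False] recip_eq_inverse[OF p False]
    by (auto simp: Lp_fun_def Lp_seminorm_def norm_mult powr_mult powr_powr)
qed

lemma Lp_fun_add:
  assumes f: "f \<in> Lp_fun p M" and k: "k \<in> Lp_fun p M" and p: "1 \<le> p"
  shows "(\<lambda>x. f x + k x) \<in> Lp_fun p M"
proof -
  have [measurable]: "f \<in> borel_measurable M" "k \<in> borel_measurable M"
    using f k by (auto simp: Lp_fun_iff_gauge)
  show ?thesis
  proof (cases "p = \<infinity>")
    case True
    have "esssup M (\<lambda>x. ennreal (cmod (f x + k x))) \<le>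
      esssup M (\<lambda>x. ennreal (cmod (f x))) + esssup M (\<lambda>x. ennreal (cmod (k x)))"
    proof (rule esssup_I)
      show "AE x in M. ennreal (cmod (f x + k x)) \<le>
        esssup M (\<lambda>x. ennreal (cmod (f x))) + esssup M (\<lambda>x. ennreal (cmod (k x)))"
        using esssup_AE[where M=M and f="\<lambda>x. ennreal (cmod (f x))"]
          esssup_AE[where M=M and f="\<lambda>x. ennreal (cmod (k x))"]
      proof eventually_elim
        case (elim x)
        have "ennreal (cmod (f x + k x)) \<le> ennreal (cmod (f x)) + ennreal (cmod (k x))"
          by (simp add: norm_triangle_ineq ennreal_leI flip: ennreal_plus)
        also note add_mono[OF elim]
        finally show ?case .
      qed
    qed simp
    then show ?thesis using True f k by (auto simp: Lp_fun_def order_le_less_trans)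
  next
    case False
    define s where "s = enn2real p"
    have s: "1 \<le> s" using enn2real_exponent_ge_1[OF p False] by (simp add: s_def)
    \<comment> \<open>Bounding the sum by twice the maximum gives a crude constant, but one that is finite.\<close>
    have *: "cmod (f x + k x) powr s \<le> 2 powr s * (cmod (f x) powr s + cmod (k x) powr s)" for x
    proof -
      have "cmod (f x + k x) \<le> 2 * max (cmod (f x)) (cmod (k x))"
        using norm_triangle_ineq[of "f x" "k x"] by linarith
      then have "cmod (f x + k x) powr s \<le> (2 * max (cmod (f x)) (cmod (k x))) powr s"
        using s by (intro powr_mono2) auto
      also have "\<dots> = 2 powr s * max (cmod (f x)) (cmod (k x)) powr s"
        by (simp add: powr_mult)
      also have "\<dots> \<le> 2 powr s * (cmod (f x) powr s + cmod (k x) powr s)"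
        by (intro mult_left_mono) (auto simp: max_def)
      finally show ?thesis .
    qed
    have "integrable M (\<lambda>x. cmod (f x) powr s)" "integrable M (\<lambda>x. cmod (k x) powr s)"
      using f k False by (auto simp: Lp_fun_def s_def)
    then have "integrable M (\<lambda>x. 2 powr s * (cmod (f x) powr s + cmod (k x) powr s))"
      by auto
    then have "integrable M (\<lambda>x. cmod (f x + k x) powr s)"
      by (rule Bochner_Integration.integrable_bound) (use * in \<open>auto intro!: order_trans[OF *]\<close>)
    then show ?thesis using False by (auto simp: Lp_fun_def s_def)
  qed
qed

lemma Lp_seminorm_const:
  assumes p: "1 \<le> p" and pos: "emeasure M (space M) \<noteq> 0" and fin: "emeasure M (space M) \<noteq> \<infinity>"
  shows "(\<lambda>_. c) \<in> Lp_fun p M"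
    and "Lp_seminorm p M (\<lambda>_. c) = cmod c * measure M (space M) powr recip p"
proof -
  have m: "measure M (space M) > 0" using pos fin
    by (simp add: emeasure_eq_ennreal_measure zero_less_measure_iff)
  have i: "integrable M (\<lambda>_. cmod c powr enn2real p)"
    by (rule finite_measure.integrable_const[OF finite_measureI[OF fin]])
  show "(\<lambda>_. c) \<in> Lp_fun p M"
    using pos i by (auto simp: Lp_fun_def esssup_const)
  show "Lp_seminorm p M (\<lambda>_. c) = cmod c * measure M (space M) powr recip p"
  proof (cases "p = \<infinity>")
    case False
    then show ?thesis using fin enn2real_exponent_ge_1[OF p False] recip_eq_inverse[OF p False]
      by (auto simp: Lp_seminorm_def powr_mult powr_powr)
  qed (use pos m in \<open>auto simp: Lp_seminorm_def esssup_const\<close>)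
qed

text \<open>
  Two disjointly supported unit vectors of \<open>L_p\<close> span a copy of the two-dimensional \<open>\<ell>_p\<close>, and the
  norm of their sum reveals \<open>1/p\<close>. An isometry that preserves disjointness of supports, as every
  multiplication operator does, therefore forces equal exponents as soon as its domain contains two
  such vectors.
\<close>
lemma Lp_seminorm_add_disjoint:
  assumes f: "f \<in> Lp_fun p M" and k: "k \<in> Lp_fun p M" and p: "1 \<le> p"
    and disj: "\<And>x. f x = 0 \<or> k x = 0"
    and nf: "Lp_seminorm p M f = 1" and nk: "Lp_seminorm p M k = 1"
  shows "Lp_seminorm p M (\<lambda>x. f x + k x) = 2 powr recip p"
proof (cases "p = \<infinity>")
  case True
  have [measurable]: "f \<in> borel_measurable M" "k \<in> borel_measurable M"
    using f k by (auto simp: Lp_fun_iff_gauge)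
  let ?e = "\<lambda>f. esssup M (\<lambda>x. ennreal (cmod (f x)))"
  have "enn2real (?e f) = 1" "enn2real (?e k) = 1"
    using nf nk True by (auto simp: Lp_seminorm_def)
  then have e: "?e f = 1" "?e k = 1"
    by (metis enn2real_1 enn2real_positive_iff ennreal_1 ennreal_enn2real zero_less_one)+
  have "?e (\<lambda>x. f x + k x) \<le> 1"
  proof (rule esssup_I)
    show "AE x in M. ennreal (cmod (f x + k x)) \<le> 1"
      using esssup_AE[where M=M and f="\<lambda>x. ennreal (cmod (f x))"]
          esssup_AE[where M=M and f="\<lambda>x. ennreal (cmod (k x))"]
    proof eventually_elim
      case (elim x)
      then show ?case using e disj[of x] by auto
    qed
  qed simp
  moreover have "?e f \<le> ?e (\<lambda>x. f x + k x)"
  proof (intro esssup_mono ennreal_leI)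
    show "cmod (f x) \<le> cmod (f x + k x)" for x using disj[of x] by auto
  qed simp
  ultimately have "?e (\<lambda>x. f x + k x) = 1" using e by auto
  then show ?thesis using True by (simp add: Lp_seminorm_def)
next
  case False
  define s where "s = enn2real p"
  have s: "1 \<le> s" "recip p = 1 / s" using enn2real_exponent_ge_1[OF p False] recip_eq_inverse[OF p False] by (auto simp add: s_def)
  have i: "integrable M (\<lambda>x. cmod (f x) powr s)" "integrable M (\<lambda>x. cmod (k x) powr s)"
    using f k False by (auto simp: Lp_fun_def s_def)
  have one: "z = 1" if "z powr (1 / s) = 1" "0 \<le> z" for z
  proof -
    have "z = (z powr (1 / s)) powr s" using s that(2) by (simp add: powr_powr)
    then show ?thesis by (simp only: that(1) powr_one_eq_one)
  qed
  have "(\<integral>x. cmod (f x) powr s \<partial>M) = 1" "(\<integral>x. cmod (k x) powr s \<partial>M) = 1"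
    using nf nk False s by (auto simp: Lp_seminorm_def s_def[symmetric] intro!: one)
  moreover have "cmod (f x + k x) powr s = cmod (f x) powr s + cmod (k x) powr s" for x
    using disj[of x] s by auto
  ultimately have "(\<integral>x. cmod (f x + k x) powr s \<partial>M) = 2" using i by simp
  then show ?thesis using False by (simp add: Lp_seminorm_def s_def)
qed

section \<open>From classes to representatives\<close>

text \<open>
  A vector of \<open>L_p\<close> is a class. The lemmas below push each operation of the normed space, and the
  multiplication operator, to representatives, so that all later arguments concern functions.
\<close>
abbreviation ae_class :: "ennreal \<Rightarrow> 'a measure \<Rightarrow> ('a \<Rightarrow> complex) \<Rightarrow> ('a \<Rightarrow> complex) set" where
  "ae_class p M f \<equiv> ae_rel p M `` {f}"

lemma vecs_Lp: "vecs (Lp p M) = ae_class p M ` Lp_fun p M"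
  by (auto simp: Lp_def quotient_def)

lemma vzero_Lp: "vzero (Lp p M) = ae_class p M (\<lambda>_. 0)"
  by (simp add: Lp_def)

lemma equiv_ae_rel: "equiv (Lp_fun p M) (ae_rel p M)"
proof (rule equivI)
  show "trans (ae_rel p M)"
    by (auto simp: trans_def ae_rel_def elim: eventually_elim2)
  show "sym (ae_rel p M)"
    by (auto simp: sym_def ae_rel_def elim: eventually_mono)
qed (auto simp: refl_on_def ae_rel_def)

lemma zero_in_Lp_fun: "(\<lambda>_. 0) \<in> Lp_fun p M"
proof -
  have "esssup M (\<lambda>x. ennreal 0) \<le> 0"
    by (rule esssup_I) auto
  then show ?thesis by (auto simp: Lp_fun_def)
qed

lemma ae_class_eq_iff:
  assumes "f \<in> Lp_fun p M" "k \<in> Lp_fun p M"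
  shows "ae_class p M f = ae_class p M k \<longleftrightarrow> (AE x in M. f x = k x)"
  using eq_equiv_class_iff[OF equiv_ae_rel assms] assms by (auto simp: ae_rel_def)

lemma ae_rel_iff:
  "(f, k) \<in> ae_rel p M \<longleftrightarrow> f \<in> Lp_fun p M \<and> k \<in> Lp_fun p M \<and> (AE x in M. f x = k x)"
  by (auto simp: ae_rel_def)

lemma vnorm_Lp:
  assumes f: "f \<in> Lp_fun p M" and p: "1 \<le> p"
  shows "vnorm (Lp p M) (ae_class p M f) = Lp_seminorm p M f"
proof -
  have "Lp_seminorm p M ` ae_class p M f = {Lp_seminorm p M f}"
  proof (intro equalityI subsetI)
    fix r assume "r \<in> Lp_seminorm p M ` ae_class p M f"
    then show "r \<in> {Lp_seminorm p M f}"
      using p by (auto simp: ae_rel_iff Lp_fun_measurable intro!: Lp_seminorm_cong_AE elim!: eventually_mono)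
  qed (use f in \<open>auto simp: ae_rel_iff\<close>)
  then show ?thesis by (simp add: Lp_def)
qed

lemma vadd_Lp:
  assumes f: "f \<in> Lp_fun p M" and k: "k \<in> Lp_fun p M" and p: "1 \<le> p"
  shows "vadd (Lp p M) (ae_class p M f) (ae_class p M k) = ae_class p M (\<lambda>x. f x + k x)"
proof -
  have "ae_class p M (\<lambda>x. f' x + k' x) = ae_class p M (\<lambda>x. f x + k x)"
    if "f' \<in> ae_class p M f" "k' \<in> ae_class p M k" for f' k'
  proof (subst ae_class_eq_iff)
    have "AE x in M. f x = f' x" "AE x in M. k x = k' x"
      using that by (auto simp: ae_rel_iff)
    then show "AE x in M. f' x + k' x = f x + k x" by eventually_elim simp
  qed (use that p in \<open>auto simp: ae_rel_iff intro!: Lp_fun_add\<close>)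
  moreover have "f \<in> ae_class p M f" "k \<in> ae_class p M k"
    using f k by (auto simp: ae_rel_iff)
  ultimately show ?thesis unfolding Lp_def nspace.simps by (intro SUP_eq_const) blast+
qed

lemma vsmult_Lp:
  assumes f: "f \<in> Lp_fun p M" and p: "1 \<le> p"
  shows "vsmult (Lp p M) c (ae_class p M f) = ae_class p M (\<lambda>x. c * f x)"
proof -
  have "ae_class p M (\<lambda>x. c * f' x) = ae_class p M (\<lambda>x. c * f x)"
    if "f' \<in> ae_class p M f" for f'
  proof (subst ae_class_eq_iff)
    have "AE x in M. f x = f' x" using that by (auto simp: ae_rel_iff)
    then show "AE x in M. c * f' x = c * f x" by eventually_elim simp
  qed (use that p in \<open>auto simp: ae_rel_iff Lp_fun_cmult\<close>)
  moreover have "f \<in> ae_class p M f"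
    using f by (auto simp: ae_rel_iff)
  ultimately show ?thesis unfolding Lp_def nspace.simps by (intro SUP_eq_const) blast+
qed

lemma mult_op_ae_class:
  assumes g: "mult_well_defined p M q N g" and f: "f \<in> Lp_fun p M"
  shows "mult_op q N g (ae_class p M f) = ae_class q N (\<lambda>x. g x * f x)"
proof -
  have "ae_class q N (\<lambda>x. g x * f' x) = ae_class q N (\<lambda>x. g x * f x)"
    if "f' \<in> ae_class p M f" for f'
  proof (subst ae_class_eq_iff)
    have "f' \<in> Lp_fun p M" "AE x in M. f' x = f x"
      using that by (auto simp: ae_rel_iff elim: eventually_mono)
    then show "AE x in N. g x * f' x = g x * f x" "(\<lambda>x. g x * f' x) \<in> Lp_fun q N"
      using g f unfolding mult_well_defined_def by blast+
  qed (use f g in \<open>auto simp: mult_well_defined_def\<close>)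
  moreover have "f \<in> ae_class p M f"
    using f by (auto simp: ae_rel_iff)
  ultimately show ?thesis unfolding mult_op_def by (intro SUP_eq_const) blast+
qed

lemma mult_well_definedD:
  assumes "mult_well_defined p M q N g" "f \<in> Lp_fun p M"
  shows "(\<lambda>x. g x * f x) \<in> Lp_fun q N"
  using assms by (auto simp: mult_well_defined_def)

lemma linear_operator_mult_op:
  assumes g: "mult_well_defined p M q N g" and p: "1 \<le> p" "1 \<le> q"
  shows "linear_operator (Lp p M) (Lp q N) (mult_op q N g)"
  using p mult_well_definedD[OF g] Lp_fun_cmult[of _ p M]
  by (auto simp: linear_operator_def vecs_Lp mult_op_ae_class[OF g] vadd_Lp vsmult_Lp Lp_fun_add
      distrib_left mult.left_commute)

lemma isometric_isomorphism_mult_op_iff: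
  assumes g: "mult_well_defined p M q N g" and p: "1 \<le> p" "1 \<le> q"
  shows "isometric_isomorphism (Lp p M) (Lp q N) (mult_op q N g) \<longleftrightarrow>
    (\<forall>f\<in>Lp_fun p M. Lp_seminorm q N (\<lambda>x. g x * f x) = Lp_seminorm p M f) \<and>
    (\<forall>y\<in>Lp_fun q N. \<exists>f\<in>Lp_fun p M. AE x in N. g x * f x = y x)"
proof -
  have "mult_op q N g ` vecs (Lp p M) = vecs (Lp q N) \<longleftrightarrow>
    (\<forall>y\<in>Lp_fun q N. \<exists>f\<in>Lp_fun p M. AE x in N. g x * f x = y x)" (is "?L \<longleftrightarrow> ?R")
  proof -
    have "?L \<longleftrightarrow> (\<forall>y\<in>Lp_fun q N. \<exists>f\<in>Lp_fun p M. ae_class q N y = ae_class q N (\<lambda>x. g x * f x))"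
    proof -
      have "mult_op q N g ` vecs (Lp p M) = (\<lambda>f. ae_class q N (\<lambda>x. g x * f x)) ` Lp_fun p M"
        by (auto simp: vecs_Lp mult_op_ae_class[OF g] image_image intro!: image_cong)
      moreover have "\<dots> \<subseteq> vecs (Lp q N)"
        using mult_well_definedD[OF g] by (auto simp: vecs_Lp)
      ultimately have "?L \<longleftrightarrow> vecs (Lp q N) \<subseteq> (\<lambda>f. ae_class q N (\<lambda>x. g x * f x)) ` Lp_fun p M"
        by (metis subset_antisym equalityD2)
      then show ?thesis
        by (simp add: vecs_Lp image_subset_iff image_iff)
    qed
    also have "\<dots> \<longleftrightarrow> ?R"
      by (intro ball_cong bex_cong refl)
        (subst ae_class_eq_iff, auto simp: mult_well_definedD[OF g] elim: eventually_mono)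
    finally show ?thesis .
  qed
  then show ?thesis
    using p mult_well_definedD[OF g]
    by (auto simp: isometric_isomorphism_def linear_operator_mult_op[OF g] vecs_Lp[of p M] mult_op_ae_class[OF g] vnorm_Lp)
qed

lemma coisometric_mult_op_iff:
  assumes g: "mult_well_defined p M q N g" and p: "1 \<le> p" "1 \<le> q"
  shows "coisometric (Lp p M) (Lp q N) (mult_op q N g) \<longleftrightarrow>
    (\<forall>f\<in>Lp_fun p M. Lp_seminorm q N (\<lambda>x. g x * f x) \<le> Lp_seminorm p M f) \<and>
    (\<forall>c'>1. \<forall>y\<in>Lp_fun q N. \<exists>f\<in>Lp_fun p M. (AE x in N. g x * f x = y x) \<and>
       (if AE x in N. y x = 0 then AE x in M. f x = 0
        else Lp_seminorm p M f < c' * Lp_seminorm q N y))"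
proof -
  have "(mult_op q N g (ae_class p M f) = ae_class q N y \<and>
      (if ae_class q N y = vzero (Lp q N) then ae_class p M f = vzero (Lp p M)
       else vnorm (Lp p M) (ae_class p M f) < c' * vnorm (Lp q N) (ae_class q N y))) \<longleftrightarrow>
    ((AE x in N. g x * f x = y x) \<and>
       (if AE x in N. y x = 0 then AE x in M. f x = 0
        else Lp_seminorm p M f < c' * Lp_seminorm q N y))"
    if "f \<in> Lp_fun p M" "y \<in> Lp_fun q N" for f y c'
    using that p mult_well_definedD[OF g that(1)]
    by (simp add: mult_op_ae_class[OF g] vzero_Lp ae_class_eq_iff zero_in_Lp_fun vnorm_Lp)
  then show ?thesis
    using p mult_well_definedD[OF g]
    by (simp add: coisometric_def contractive_def linear_operator_mult_op[OF g] vecs_Lp mult_op_ae_class[OF g] vnorm_Lp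
       cong: conj_cong)
qed

section \<open>Strictly positive test functions and atoms\<close>

text \<open>
  With \<open>0 < h \<le> 1\<close> and \<open>h\<close> integrable, \<open>h\<^sup>r \<le> h\<close> for all \<open>r \<ge> 1\<close>, so one function lies in all
  spaces \<open>L_r\<close>. Products \<open>1\<^sub>E \<cdot> h\<close> then test arbitrary measurable sets \<open>E\<close>, also those of
  infinite measure.
\<close>
lemma sigma_finite_obtain_positive_Lp_fun:
  assumes "sigma_finite_measure M"
  obtains h :: "'a \<Rightarrow> real" where "h \<in> borel_measurable M" "\<And>x. 0 < h x"
    "\<And>r. 1 \<le> r \<Longrightarrow> (\<lambda>x. complex_of_real (h x)) \<in> Lp_fun r M"
proof -
  obtain h :: "'a \<Rightarrow> real" where h [measurable]: "h \<in> borel_measurable M"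
    and pos: "\<And>x. 0 < h x" and le: "\<And>x. h x \<le> 1" and int: "integrable M h"
    using sigma_finite_measure.obtain_positive_integrable_function[OF assms] by metis
  have "(\<lambda>x. complex_of_real (h x)) \<in> Lp_fun r M" if r: "1 \<le> r" for r
  proof (cases "r = \<infinity>")
    case True
    have "esssup M (\<lambda>x. ennreal (cmod (complex_of_real (h x)))) \<le> 1"
      using le pos by (intro esssup_I) (auto simp: less_imp_le)
    then show ?thesis using True by (auto simp: Lp_fun_def order_le_less_trans)
  next
    case False
    have "norm (cmod (complex_of_real (h x)) powr enn2real r) \<le> norm (h x)" for x
      using pos[of x] le[of x] powr_mono'[of 1 "enn2real r" "h x"] enn2real_exponent_ge_1[OF r False]
      by auto
    then have "integrable M (\<lambda>x. cmod (complex_of_real (h x)) powr enn2real r)"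
      using int by (intro Bochner_Integration.integrable_bound[OF int]) auto
    then show ?thesis using False by (auto simp: Lp_fun_def)
  qed
  with h pos show ?thesis using that by blast
qed

text \<open>
  If every point had a neighbourhood with null preimage, countably many of them would cover the
  codomain and the atom would be null. So all neighbourhoods of some \<open>c\<close> have non-null preimage,
  hence conull preimage since the space is an atom, and shrinking balls around \<open>c\<close> give \<open>f = c\<close>.
\<close>
lemma single_atom_space_AE_const:
  fixes f :: "'a \<Rightarrow> 'b::{second_countable_topology, metric_space}"
  assumes atom: "single_atom_space M" and f [measurable]: "f \<in> borel_measurable M"
  obtains c where "AE x in M. f x = c"
proof -
  have "\<exists>c. \<forall>U. open U \<and> c \<in> U \<longrightarrow> \<not> (AE x in M. f x \<notin> U)"
  proof (rule ccontr)
    assume "\<not> ?thesis"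
    then have cover: "\<exists>U. open U \<and> c \<in> U \<and> (AE x in M. f x \<notin> U)" for c by blast
    define F where "F = {U. open U \<and> (AE x in M. f x \<notin> U)}"
    obtain F' where F': "F' \<subseteq> F" "countable F'" "\<Union>F' = \<Union>F"
      using Lindelof[of F] by (auto simp: F_def)
    have "AE x in M. \<forall>U\<in>F'. f x \<notin> U"
      using F' by (subst AE_ball_countable) (auto simp: F_def)
    moreover have "\<Union>F' = UNIV" using cover unfolding F'(3) F_def by blast
    ultimately have "AE x in M. False" by (auto elim!: eventually_mono)
    then show False
      using atom by (simp add: single_atom_space_def is_atom_def AE_iff_measurable[OF sets.top])
  qed
  then obtain c where c: "\<And>U. open U \<Longrightarrow> c \<in> U \<Longrightarrow> \<not> (AE x in M. f x \<notin> U)" by blast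
  have "AE x in M. f x \<in> U" if U: "open U" "c \<in> U" for U
  proof -
    have [measurable]: "U \<in> sets borel" using U by auto
    let ?E = "{x \<in> space M. f x \<in> U}"
    have "?E \<in> sets M" by measurable
    then have "emeasure M ?E = 0 \<or> emeasure M (space M - ?E) = 0"
      using atom by (auto simp: single_atom_space_def is_atom_def)
    moreover have "emeasure M ?E \<noteq> 0"
      using c[OF U] AE_iff_measurable[of ?E M "\<lambda>x. f x \<notin> U"] \<open>?E \<in> sets M\<close> by auto
    moreover have "space M - ?E = {x \<in> space M. \<not> f x \<in> U}" by auto
    ultimately show ?thesis
      using \<open>?E \<in> sets M\<close> by (subst AE_iff_measurable[OF _ refl]) auto
  qed
  from this[OF open_ball] have "AE x in M. \<forall>n. dist c (f x) < inverse (real (Suc n))"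
    unfolding AE_all_countable by (simp add: mem_ball)
  then have "AE x in M. f x = c"
  proof eventually_elim
    case (elim x)
    show ?case
    proof (rule ccontr)
      assume "f x \<noteq> c"
      then obtain n where "inverse (real (Suc n)) < dist c (f x)"
        using reals_Archimedean[of "dist c (f x)"] by auto
      with elim show False by (meson less_asym)
    qed
  qed
  then show ?thesis using that by blast
qed

text \<open>
  On an atom a strictly positive integrable function is a positive constant.
\<close>
lemma single_atom_space_finite:
  assumes "sigma_finite_measure M" and atom: "single_atom_space M"
  shows "emeasure M (space M) \<noteq> \<infinity>"
proof -
  obtain h :: "'a \<Rightarrow> real" where h: "h \<in> borel_measurable M" "\<And>x. 0 < h x" "integrable M h"
    using sigma_finite_measure.obtain_positive_integrable_function[OF assms(1)] by metis
  obtain c where c: "AE x in M. h x = c"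
    using single_atom_space_AE_const[OF atom h(1)] by blast
  have "c > 0"
  proof (rule ccontr)
    assume "\<not> c > 0"
    with c h(2) have "AE x in M. False" by (auto elim!: eventually_mono)
    then show False
      using atom by (simp add: single_atom_space_def is_atom_def AE_iff_measurable[OF sets.top])
  qed
  have "(\<integral>\<^sup>+x. ennreal (h x) \<partial>M) = (\<integral>\<^sup>+x. ennreal c \<partial>M)"
    using c by (intro nn_integral_cong_AE) (auto elim: eventually_mono)
  moreover have "(\<integral>\<^sup>+x. ennreal (h x) \<partial>M) < \<infinity>"
    using h by (auto simp: integrable_iff_bounded less_imp_le)
  ultimately show ?thesis using \<open>c > 0\<close> by (auto simp: ennreal_mult_top)
qed

section \<open>Surjective isometries when the source measure has a density\<close>

text \<open>
  The situation on the continuous part: there \<open>\<mu>\<close> is \<open>\<rho> \<cdot> \<nu>\<close>. Here \<open>M\<close> stands for \<open>\<mu>\<close> and \<open>N\<close>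
  for \<open>\<nu>\<close>, both already restricted.
\<close>

locale density_multiplication =
  fixes M N :: "'a measure" and p q :: ennreal and g :: "'a \<Rightarrow> complex" and \<rho> :: "'a \<Rightarrow> real"
  assumes sigma_finite_M: "sigma_finite_measure M"
    and sigma_finite_N: "sigma_finite_measure N"
    and \<rho> [measurable]: "\<rho> \<in> borel_measurable N"
    and M_eq: "M = density N (\<lambda>x. ennreal (\<rho> x))"
    and g [measurable]: "g \<in> borel_measurable N"
    and p: "1 \<le> p" and q: "1 \<le> q"
    and well_defined: "mult_well_defined p M q N g"
begin

text \<open>
  Together with surjectivity this says that the multiplication operator is an isometric isomorphism,
  by \<open>isometric_isomorphism_mult_op_iff\<close>.
\<close>
definition isometric :: bool where
  "isometric \<longleftrightarrow> (\<forall>f\<in>Lp_fun p M. Lp_seminorm q N (\<lambda>x. g x * f x) = Lp_seminorm p M f)"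

definition surjective :: bool where
  "surjective \<longleftrightarrow> (\<forall>y\<in>Lp_fun q N. \<exists>f\<in>Lp_fun p M. AE x in N. g x * f x = y x)"

lemma sets_M [simp, measurable_cong]: "sets M = sets N" and space_M [simp]: "space M = space N"
  by (simp_all add: M_eq)

lemma borel_measurable_M [simp]: "borel_measurable M = borel_measurable N"
  by (rule measurable_cong_sets) auto

lemma AE_M_iff: "(AE x in M. P x) \<longleftrightarrow> (AE x in N. 0 < \<rho> x \<longrightarrow> P x)"
  unfolding M_eq by (subst AE_density) auto

lemma AE_M_iff_AE_N:
  assumes "AE x in N. 0 < \<rho> x"
  shows "(AE x in M. P x) \<longleftrightarrow> (AE x in N. P x)"
  unfolding AE_M_iff using assms by (auto elim: eventually_elim2)

text \<open>
  The range, being all of \<open>L_q(N)\<close>, contains a function that vanishes nowhere.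
\<close>
lemma surjective_imp_nonzero:
  assumes "surjective"
  shows "AE x in N. g x \<noteq> 0"
proof -
  obtain h :: "'a \<Rightarrow> real" where h: "\<And>x. 0 < h x"
    "\<And>r. 1 \<le> r \<Longrightarrow> (\<lambda>x. complex_of_real (h x)) \<in> Lp_fun r N"
    using sigma_finite_obtain_positive_Lp_fun[OF sigma_finite_N] by metis
  obtain f where "AE x in N. g x * f x = complex_of_real (h x)"
    using assms h(2)[OF q] by (auto simp: surjective_def)
  then show ?thesis
  proof eventually_elim
    case (elim x)
    then show ?case using h(1)[of x] by auto
  qed
qed

text \<open>
  Functions supported in \<open>{\<rho> \<le> 0}\<close>, where the density \<open>ennreal \<circ> \<rho>\<close> is \<open>0\<close>, represent \<open>0\<close> in \<open>L_p(M)\<close>. Well-definedness of the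
  multiplication operator on classes sends them to \<open>0\<close> in \<open>L_q(N)\<close>, which forces \<open>g = 0\<close> on that set.
\<close>
lemma nonzero_imp_density_pos:
  assumes "AE x in N. g x \<noteq> 0"
  shows "AE x in N. 0 < \<rho> x"
proof -
  obtain h :: "'a \<Rightarrow> real" where h: "\<And>x. 0 < h x"
    "\<And>r. 1 \<le> r \<Longrightarrow> (\<lambda>x. complex_of_real (h x)) \<in> Lp_fun r M"
    using sigma_finite_obtain_positive_Lp_fun[OF sigma_finite_M] by metis
  have [measurable]: "(\<lambda>x. complex_of_real (h x)) \<in> borel_measurable N"
    using Lp_fun_measurable[OF h(2)[OF p]] by simp
  define f where "f = (\<lambda>x. if \<rho> x \<le> 0 then complex_of_real (h x) else 0)"
  have "f \<in> borel_measurable N" unfolding f_def by measurable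
  then have "f \<in> Lp_fun p M"
    using p by (intro Lp_fun_mono_AE[OF _ h(2)]) (auto simp: f_def)
  moreover have "AE x in M. f x = 0"
    unfolding AE_M_iff by (auto simp: f_def)
  ultimately have "AE x in N. g x * f x = g x * 0"
    using well_defined zero_in_Lp_fun[of p M] unfolding mult_well_defined_def by fast
  with assms show ?thesis
  proof eventually_elim
    case (elim x)
    then show ?case using h(1)[of x] by (auto simp: f_def split: if_splits)
  qed
qed

text \<open>
  Isometry on all \<open>1\<^sub>E \<cdot> h\<close> says that the measures \<open>\<rho> h\<^sup>p \<cdot> N\<close> and \<open>|g|\<^sup>p h\<^sup>p \<cdot> N\<close> agree, and
  densities with respect to a \<open>\<sigma>\<close>-finite measure are unique.
\<close>
lemma isometric_same_exponent_finite:
  assumes iso: isometric and pq: "p = q" and fin: "p \<noteq> \<infinity>" and pos: "AE x in N. 0 < \<rho> x"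
  shows "AE x in N. cmod (g x) = \<rho> x powr recip p"
proof -
  define s where "s = enn2real p"
  have s: "1 \<le> s" "recip p = 1 / s"
    using enn2real_exponent_ge_1[OF p fin] recip_eq_inverse[OF p fin] by (auto simp: s_def)
  obtain h :: "'a \<Rightarrow> real" where h [measurable]: "h \<in> borel_measurable M" and hpos: "\<And>x. 0 < h x"
    and hL: "\<And>r. 1 \<le> r \<Longrightarrow> (\<lambda>x. complex_of_real (h x)) \<in> Lp_fun r M"
    using sigma_finite_obtain_positive_Lp_fun[OF sigma_finite_M] by metis
  have [measurable]: "h \<in> borel_measurable N" using h by simp
  have "density N (\<lambda>x. ennreal (\<rho> x) * ennreal (h x powr s)) = density N (\<lambda>x. ennreal (cmod (g x) powr s * h x powr s))"
  proof (rule measure_eqI)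
    fix E assume "E \<in> sets (density N (\<lambda>x. ennreal (\<rho> x) * ennreal (h x powr s)))"
    then have [measurable]: "E \<in> sets N" by simp
    define f where "f = (\<lambda>x. indicator E x * complex_of_real (h x))"
    have f: "f \<in> Lp_fun p M"
      using p by (intro Lp_fun_mono_AE[OF _ hL]) (auto simp: f_def indicator_def)
    then have gf: "(\<lambda>x. g x * f x) \<in> Lp_fun p N"
      using well_defined pq by (auto intro: mult_well_definedD)
    have "Lp_seminorm q N (\<lambda>x. g x * f x) = Lp_seminorm p M f"
      using iso f by (simp add: isometric_def)
    then have "Lp_seminorm p N (\<lambda>x. g x * f x) = Lp_seminorm p M f"
      using pq by simp
    then have "enn2real (Lp_gauge p N (\<lambda>x. g x * f x)) powr (1 / s) = enn2real (Lp_gauge p M f) powr (1 / s)"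
      using Lp_fun_measurable[OF f] Lp_fun_measurable[OF gf] fin s by (simp add: Lp_seminorm_eq_gauge)
    then have "(enn2real (Lp_gauge p N (\<lambda>x. g x * f x)) powr (1 / s)) powr s =
        (enn2real (Lp_gauge p M f) powr (1 / s)) powr s"
      by (rule arg_cong)
    then have "enn2real (Lp_gauge p N (\<lambda>x. g x * f x)) = enn2real (Lp_gauge p M f)"
      using s unfolding powr_powr by simp
    then have "Lp_gauge p N (\<lambda>x. g x * f x) = Lp_gauge p M f"
      using f gf by (metis Lp_fun_iff_gauge ennreal_enn2real infinity_ennreal_def)
    moreover have "Lp_gauge p N (\<lambda>x. g x * f x) =
      (\<integral>\<^sup>+x. ennreal (cmod (g x) powr s * h x powr s) * indicator E x \<partial>N)"
      unfolding Lp_gauge_def s_def[symmetric] using fin s hpos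
      by (auto intro!: nn_integral_cong simp: f_def indicator_def norm_mult powr_mult less_imp_le abs_of_pos)
    moreover have "Lp_gauge p M f = (\<integral>\<^sup>+x. ennreal (\<rho> x) * ennreal (h x powr s) * indicator E x \<partial>N)"
    proof -
      have "f \<in> borel_measurable N" unfolding f_def by measurable
      then have "Lp_gauge p M f = (\<integral>\<^sup>+x. ennreal (\<rho> x) * ennreal (cmod (f x) powr s) \<partial>N)"
        using fin by (simp add: Lp_gauge_def s_def[symmetric] M_eq nn_integral_density)
      also have "\<dots> = (\<integral>\<^sup>+x. ennreal (\<rho> x) * ennreal (h x powr s) * indicator E x \<partial>N)"
        using s hpos by (auto intro!: nn_integral_cong simp: f_def indicator_def abs_of_pos)
      finally show ?thesis .
    qed
    ultimately show "emeasure (density N (\<lambda>x. ennreal (\<rho> x) * ennreal (h x powr s))) E =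
        emeasure (density N (\<lambda>x. ennreal (cmod (g x) powr s * h x powr s))) E"
      by (simp add: emeasure_density)
  qed simp
  then have "AE x in N. ennreal (\<rho> x) * ennreal (h x powr s) = ennreal (cmod (g x) powr s * h x powr s)"
    by (intro sigma_finite_measure.density_unique[OF sigma_finite_N]) auto
  with pos show ?thesis
  proof eventually_elim
    case (elim x)
    have "\<rho> x * h x powr s = cmod (g x) powr s * h x powr s"
      using elim by (simp add: ennreal_mult[symmetric] less_imp_le)
    then have "\<rho> x = cmod (g x) powr s"
      using hpos[of x] by (metis mult_right_cancel powr_eq_0_iff less_irrefl)
    then show ?case using s by (simp add: powr_powr)
  qed
qed

text \<open>
  The function \<open>g\<close> is the image of \<open>1\<close>, so \<open>|g| \<le> 1\<close>. The preimage of \<open>1\<close> is \<open>1/g\<close>, and it has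
  norm at most \<open>1\<close> as well, so \<open>|g| \<ge> 1\<close>.
\<close>
lemma isometric_same_exponent_infinite:
  assumes iso: isometric and surj: surjective and pq: "p = \<infinity>" "q = \<infinity>" and pos: "AE x in N. 0 < \<rho> x"
  shows "AE x in N. cmod (g x) = 1"
proof -
  have bound: "AE x in K. cmod (f x) \<le> 1" if "f \<in> Lp_fun \<infinity> K" "Lp_seminorm \<infinity> K f \<le> 1" for f and K :: "'a measure"
  proof -
    let ?e = "esssup K (\<lambda>x. ennreal (cmod (f x)))"
    have "?e = ennreal (enn2real ?e)" using that by (simp add: Lp_fun_def less_top)
    also have "\<dots> \<le> 1" using that(2) by (simp add: Lp_seminorm_def)
    finally have e: "?e \<le> 1" .
    show ?thesis
      using esssup_AE[where M=K and f="\<lambda>x. ennreal (cmod (f x))"]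
    proof eventually_elim
      case (elim x)
      then have "ennreal (cmod (f x)) \<le> 1" using e by (rule order_trans)
      then show ?case by simp
    qed
  qed
  have one: "(\<lambda>_. 1) \<in> Lp_fun \<infinity> K" "Lp_seminorm \<infinity> K (\<lambda>_. 1) \<le> 1" for K :: "'a measure"
  proof -
    have e: "esssup K (\<lambda>x. ennreal (cmod 1)) \<le> 1" by (rule esssup_I) auto
    show "(\<lambda>_. 1) \<in> Lp_fun \<infinity> K" using e by (auto simp: Lp_fun_def order_le_less_trans)
    show "Lp_seminorm \<infinity> K (\<lambda>_. 1) \<le> 1" using enn2real_mono[OF e] by (auto simp: Lp_seminorm_def)
  qed
  have "(\<lambda>x. g x * 1) \<in> Lp_fun \<infinity> N" "Lp_seminorm \<infinity> N (\<lambda>x. g x * 1) \<le> 1"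
    using mult_well_definedD[OF well_defined, of "\<lambda>_. 1"] iso[unfolded isometric_def, rule_format, of "\<lambda>_. 1"]
      one[of M] pq by auto
  then have le: "AE x in N. cmod (g x) \<le> 1" using bound[of g N] by simp
  obtain f where f: "f \<in> Lp_fun \<infinity> M" and gf: "AE x in N. g x * f x = 1"
    using surj[unfolded surjective_def, rule_format, of "\<lambda>_. 1"] one(1)[of N] pq by auto
  have "Lp_seminorm \<infinity> M f = Lp_seminorm \<infinity> N (\<lambda>x. g x * f x)"
    using iso[unfolded isometric_def, rule_format, of f] f pq by simp
  also have "\<dots> = Lp_seminorm \<infinity> N (\<lambda>_. 1)"
    using mult_well_definedD[OF well_defined, of f] f gf pq
    by (intro Lp_seminorm_cong_AE) (auto simp: Lp_fun_measurable elim!: eventually_mono)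
  finally have "AE x in M. cmod (f x) \<le> 1" using bound[OF f] one(2)[of N] by simp
  then have "AE x in N. cmod (f x) \<le> 1" using AE_M_iff_AE_N[OF pos] by simp
  with le gf show ?thesis
  proof eventually_elim
    case (elim x)
    have "1 = cmod (g x) * cmod (f x)" using elim(2) by (simp add: norm_mult[symmetric])
    also have "\<dots> \<le> cmod (g x) * 1" using elim by (intro mult_left_mono) auto
    finally show ?case using elim by simp
  qed
qed

text \<open>
  Splitting the space into two non-null parts yields disjointly supported unit vectors \<open>u\<close> and \<open>v\<close>,
  whose images are again disjointly supported unit vectors. Comparing the norms of \<open>u + v\<close> and its
  image gives \<open>2\<close> to the powers \<open>1/p\<close> and \<open>1/q\<close>, so \<open>p = q\<close>.
\<close>
lemma isometric_imp_single_atom: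
  assumes iso: isometric and pq: "p \<noteq> q" and nz: "emeasure M (space M) \<noteq> 0"
  shows "single_atom_space M"
proof (rule ccontr)
  assume "\<not> single_atom_space M"
  then obtain E where E: "E \<in> sets M" "emeasure M E \<noteq> 0" "emeasure M (space M - E) \<noteq> 0"
    using nz by (auto simp: single_atom_space_def is_atom_def zero_less_iff_neq_zero)
  obtain h :: "'a \<Rightarrow> real" where [measurable]: "h \<in> borel_measurable M" and hpos: "\<And>x. 0 < h x"
    and hL: "\<And>r. 1 \<le> r \<Longrightarrow> (\<lambda>x. complex_of_real (h x)) \<in> Lp_fun r M"
    using sigma_finite_obtain_positive_Lp_fun[OF sigma_finite_M] by metis
  have unit: "\<exists>u\<in>Lp_fun p M. Lp_seminorm p M u = 1 \<and> (\<forall>x. x \<notin> D \<longrightarrow> u x = 0)"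
    if D [measurable]: "D \<in> sets M" and nD: "emeasure M D \<noteq> 0" for D
  proof -
    define f where "f = (\<lambda>x. indicator D x * complex_of_real (h x))"
    have [measurable]: "f \<in> borel_measurable M" unfolding f_def by measurable
    have f: "f \<in> Lp_fun p M"
      using p by (intro Lp_fun_mono_AE[OF _ hL]) (auto simp: f_def indicator_def)
    have "{x \<in> space M. f x \<noteq> 0} = D"
      using hpos sets.sets_into_space[OF D] by (auto simp: f_def indicator_def less_le)
    then have "\<not> (AE x in M. f x = 0)"
      using nD by (subst AE_iff_measurable[OF _ refl]) (auto simp: D)
    then have "Lp_seminorm p M f \<noteq> 0" using Lp_seminorm_eq_0_iff[OF f p] by simp
    then show ?thesis
      using Lp_fun_cmult[OF f p, of "complex_of_real (1 / Lp_seminorm p M f)"] Lp_seminorm_nonneg[of p M f]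
      by (intro bexI[of _ "\<lambda>x. complex_of_real (1 / Lp_seminorm p M f) * f x"])
        (auto simp: norm_divide f_def)
  qed
  obtain u where u: "u \<in> Lp_fun p M" "Lp_seminorm p M u = 1" "\<And>x. x \<notin> E \<Longrightarrow> u x = 0"
    using unit[OF E(1,2)] by blast
  obtain v where v: "v \<in> Lp_fun p M" "Lp_seminorm p M v = 1" "\<And>x. x \<notin> space M - E \<Longrightarrow> v x = 0"
    using unit[OF _ E(3)] E(1) by blast
  have disj: "u x = 0 \<or> v x = 0" for x using u(3) v(3) by blast
  have "2 powr recip p = Lp_seminorm p M (\<lambda>x. u x + v x)"
    using Lp_seminorm_add_disjoint[OF u(1) v(1) p disj u(2) v(2)] by simp
  also have "\<dots> = Lp_seminorm q N (\<lambda>x. g x * (u x + v x))"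
    using iso Lp_fun_add[OF u(1) v(1) p] by (simp add: isometric_def)
  also have "\<dots> = Lp_seminorm q N (\<lambda>x. g x * u x + g x * v x)"
    by (simp add: distrib_left)
  also have "\<dots> = 2 powr recip q"
    using disj iso u(1,2) v(1,2) q
    by (intro Lp_seminorm_add_disjoint) (auto simp: isometric_def intro: mult_well_definedD[OF well_defined])
  finally have "recip p = recip q" using powr_inj[of 2 "recip p" "recip q"] by simp
  then show False using recip_inject[OF p q] pq by simp
qed

text \<open>
  On an atom \<open>\<rho>\<close> is a constant \<open>r\<close>, whence \<open>\<mu> = r \<cdot> \<nu>\<close> and \<open>\<nu>\<close> inherits finiteness from \<open>\<mu>\<close>.
\<close>
lemma single_atom_density:
  assumes atom: "single_atom_space M" and pos: "AE x in N. 0 < \<rho> x"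
  obtains r where "0 < r" "AE x in N. \<rho> x = r" "measure M (space M) = r * measure N (space N)"
    "0 < measure N (space N)" "emeasure N (space N) \<noteq> \<infinity>"
proof -
  obtain r where "AE x in M. \<rho> x = r"
    using single_atom_space_AE_const[OF atom, of \<rho>] by auto
  then have r: "AE x in N. \<rho> x = r" using AE_M_iff_AE_N[OF pos] by simp
  have M0: "emeasure M (space M) \<noteq> 0" and Mfin: "emeasure M (space M) \<noteq> \<infinity>"
    using atom single_atom_space_finite[OF sigma_finite_M atom]
    by (auto simp: single_atom_space_def is_atom_def)
  have eq: "emeasure M (space M) = ennreal r * emeasure N (space N)"
  proof -
    have "emeasure M (space M) = (\<integral>\<^sup>+x. ennreal (\<rho> x) \<partial>N)"
      by (simp add: M_eq emeasure_density cong: nn_integral_cong)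
    also have "\<dots> = (\<integral>\<^sup>+x. ennreal r \<partial>N)"
      using r by (intro nn_integral_cong_AE) (auto elim: eventually_mono)
    finally show ?thesis by simp
  qed
  then have "0 < r" using M0 by (metis ennreal_eq_0_iff linorder_not_le mult_zero_left)
  have N0: "emeasure N (space N) \<noteq> 0" using eq M0 by auto
  have Nfin: "emeasure N (space N) \<noteq> \<infinity>" using eq Mfin \<open>0 < r\<close> by (auto simp: ennreal_mult_top)
  have "measure M (space M) = r * measure N (space N)"
    using eq \<open>0 < r\<close> by (simp add: measure_def enn2real_mult)
  moreover have "0 < measure N (space N)"
    using N0 Nfin by (simp add: emeasure_eq_ennreal_measure zero_less_measure_iff)
  ultimately show ?thesis using that r \<open>0 < r\<close> Nfin by blast
qed

lemma cmod_mult_powr_uminus_iff: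
  assumes "0 < \<rho> x"
  shows "cmod (g x * complex_of_real (\<rho> x powr (- recip p))) = K \<longleftrightarrow> cmod (g x) = K * \<rho> x powr recip p"
  using assms by (auto simp: norm_mult norm_divide powr_minus field_simps)

text \<open>
  It suffices to compare the norms of the constant function \<open>1\<close> and of its image \<open>g\<close>, as \<open>|g|\<close> and
  \<open>\<rho>\<close> are constants \<open>\<gamma>\<close> and \<open>r\<close> on the atom: \<open>\<gamma> \<nu>(\<Omega>)\<^sup>1\<^sup>/\<^sup>q = (r \<nu>(\<Omega>))\<^sup>1\<^sup>/\<^sup>p\<close>.
\<close>
lemma isometric_imp_atom_modulus:
  assumes iso: isometric and atom: "single_atom_space M" and pos: "AE x in N. 0 < \<rho> x"
  shows "AE x in N. cmod (g x) = measure N (space N) powr (recip p - recip q) * \<rho> x powr recip p"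
proof -
  obtain r where r: "0 < r" "AE x in N. \<rho> x = r" "measure M (space M) = r * measure N (space N)"
    "0 < measure N (space N)" "emeasure N (space N) \<noteq> \<infinity>"
    using single_atom_density[OF atom pos] .
  have M0: "emeasure M (space M) \<noteq> 0" and Mfin: "emeasure M (space M) \<noteq> \<infinity>"
    using atom single_atom_space_finite[OF sigma_finite_M atom]
    by (auto simp: single_atom_space_def is_atom_def)
  have N0: "emeasure N (space N) \<noteq> 0" using r(4) by (auto simp: measure_def)
  obtain \<gamma> where "AE x in M. cmod (g x) = \<gamma>"
    using single_atom_space_AE_const[OF atom, of "\<lambda>x. cmod (g x)"] by auto
  then have \<gamma>: "AE x in N. cmod (g x) = \<gamma>" using AE_M_iff_AE_N[OF pos] by simp
  have "\<gamma> \<ge> 0"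
  proof (rule ccontr)
    assume "\<not> \<gamma> \<ge> 0"
    have "AE x in N. False"
      using \<gamma> by eventually_elim (use \<open>\<not> \<gamma> \<ge> 0\<close> norm_ge_zero in metis)
    then show False using N0 by (simp add: AE_iff_measurable[OF sets.top])
  qed
  have "Lp_seminorm q N (\<lambda>x. g x * 1) = Lp_seminorm q N (\<lambda>x. complex_of_real \<gamma>)"
    using \<gamma> \<open>\<gamma> \<ge> 0\<close> q by (intro Lp_seminorm_cong_AE) (auto elim: eventually_mono)
  also have "\<dots> = \<gamma> * measure N (space N) powr recip q"
    using Lp_seminorm_const(2)[OF q N0 r(5), of "complex_of_real \<gamma>"] \<open>\<gamma> \<ge> 0\<close> by simp
  also have "Lp_seminorm q N (\<lambda>x. g x * 1) = Lp_seminorm p M (\<lambda>_. 1)"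
    using iso[unfolded isometric_def, rule_format, of "\<lambda>_. 1"] Lp_seminorm_const(1)[OF p M0 Mfin, of 1]
    by simp
  also have "\<dots> = measure M (space M) powr recip p"
    using Lp_seminorm_const(2)[OF p M0 Mfin, of 1] by simp
  finally have "\<gamma> = measure N (space N) powr (recip p - recip q) * r powr recip p"
    using r by (simp add: powr_mult powr_diff field_simps)
  with \<gamma> r(2) show ?thesis by (auto elim: eventually_elim2)
qed

text \<open>
  The assumption on \<open>|g|\<close> makes the gauges of \<open>f\<close> and \<open>g \<cdot> f\<close> equal for all measurable \<open>f\<close>. Applied
  to \<open>f = y/g\<close> this also shows that the only candidate for a preimage of \<open>y\<close> lies in \<open>L_p\<close>.
\<close>
lemma same_exponent_modulus_imp_isometry:
  assumes pq: "p = q" and pos: "AE x in N. 0 < \<rho> x"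
    and mod: "AE x in N. cmod (g x) = \<rho> x powr recip p"
  shows "isometric \<and> surjective"
proof
  have gauge: "Lp_gauge p M f = Lp_gauge p N (\<lambda>x. g x * f x)" if [measurable]: "f \<in> borel_measurable N" for f
    unfolding M_eq
  proof (rule Lp_gauge_density_AE)
    show "AE x in N. cmod (g x * f x) = cmod (f x) * \<rho> x powr recip p"
      using mod by eventually_elim (simp add: norm_mult)
  qed (use pos p in auto)
  show isometric
    unfolding isometric_def
  proof
    fix f assume "f \<in> Lp_fun p M"
    then have [measurable]: "f \<in> borel_measurable N" using Lp_fun_measurable by force
    have "Lp_seminorm p N (\<lambda>x. g x * f x) = Lp_seminorm p M f"
      using gauge[of f] by (simp add: Lp_seminorm_eq_gauge)
    then show "Lp_seminorm q N (\<lambda>x. g x * f x) = Lp_seminorm p M f" using pq by simp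
  qed
  show surjective
    unfolding surjective_def
  proof
    fix y assume y: "y \<in> Lp_fun q N"
    have [measurable]: "y \<in> borel_measurable N" using y by (simp add: Lp_fun_measurable)
    have eq: "AE x in N. g x * (y x / g x) = y x"
      using mod pos by eventually_elim auto
    have "Lp_gauge p M (\<lambda>x. y x / g x) = Lp_gauge p N (\<lambda>x. g x * (y x / g x))"
      by (rule gauge) measurable
    also have "\<dots> = Lp_gauge p N y"
      using eq p by (intro Lp_gauge_cong_AE) (auto elim: eventually_mono)
    finally have "(\<lambda>x. y x / g x) \<in> Lp_fun p M"
      using y pq by (simp add: Lp_fun_iff_gauge)
    with eq show "\<exists>f\<in>Lp_fun p M. AE x in N. g x * f x = y x"
      by (intro bexI[of _ "\<lambda>x. y x / g x"])
  qed
qed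

text \<open>
  Both spaces consist of constants only, so the norms are explicit.
\<close>
lemma atom_modulus_imp_isometry:
  assumes atom: "single_atom_space M" and pos: "AE x in N. 0 < \<rho> x"
    and mod: "AE x in N. cmod (g x) = measure N (space N) powr (recip p - recip q) * \<rho> x powr recip p"
  shows "isometric \<and> surjective"
proof
  obtain r where r: "0 < r" "AE x in N. \<rho> x = r" "measure M (space M) = r * measure N (space N)"
    "0 < measure N (space N)" "emeasure N (space N) \<noteq> \<infinity>"
    using single_atom_density[OF atom pos] .
  have M0: "emeasure M (space M) \<noteq> 0" and Mfin: "emeasure M (space M) \<noteq> \<infinity>"
    using atom single_atom_space_finite[OF sigma_finite_M atom]
    by (auto simp: single_atom_space_def is_atom_def)
  have N0: "emeasure N (space N) \<noteq> 0" using r(4) by (auto simp: measure_def)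
  define \<gamma> where "\<gamma> = measure N (space N) powr (recip p - recip q) * r powr recip p"
  have \<gamma>: "AE x in N. cmod (g x) = \<gamma>" "\<gamma> > 0"
    using mod r by (auto simp: \<gamma>_def elim: eventually_elim2)
  show isometric
    unfolding isometric_def
  proof
    fix f assume f: "f \<in> Lp_fun p M"
    have [measurable]: "f \<in> borel_measurable N" using Lp_fun_measurable[OF f] by simp
    obtain c where c: "AE x in M. f x = c"
      using single_atom_space_AE_const[OF atom Lp_fun_measurable[OF f]] .
    then have cN: "AE x in N. f x = c" using AE_M_iff_AE_N[OF pos] by simp
    have "AE x in N. cmod (g x * f x) = cmod (complex_of_real \<gamma> * c)"
      using cN \<gamma>(1) by eventually_elim (use \<gamma>(2) in \<open>auto simp: norm_mult\<close>)
    then have "Lp_seminorm q N (\<lambda>x. g x * f x) = Lp_seminorm q N (\<lambda>_. complex_of_real \<gamma> * c)"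
      using q by (intro Lp_seminorm_cong_AE) auto
    also have "\<dots> = \<gamma> * cmod c * measure N (space N) powr recip q"
      using Lp_seminorm_const(2)[OF q N0 r(5)] \<gamma>(2) by (simp add: norm_mult)
    also have "\<dots> = cmod c * measure M (space M) powr recip p"
      using r by (simp add: \<gamma>_def powr_mult powr_diff)
    also have "\<dots> = Lp_seminorm p M (\<lambda>_. c)"
      using Lp_seminorm_const(2)[OF p M0 Mfin] by simp
    also have "\<dots> = Lp_seminorm p M f"
      using c p by (intro Lp_seminorm_cong_AE) (auto elim: eventually_mono)
    finally show "Lp_seminorm q N (\<lambda>x. g x * f x) = Lp_seminorm p M f" .
  qed
  show surjective
    unfolding surjective_def
  proof
    fix y assume y: "y \<in> Lp_fun q N"
    have [measurable]: "y \<in> borel_measurable N" using y by (simp add: Lp_fun_measurable)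
    have eq: "AE x in N. g x * (y x / g x) = y x"
      using \<gamma>(1) by eventually_elim (use \<gamma>(2) in auto)
    have meas: "(\<lambda>x. y x / g x) \<in> borel_measurable M" by simp
    obtain c where c: "AE x in M. y x / g x = c"
      using single_atom_space_AE_const[OF atom meas] .
    then have "(\<lambda>x. y x / g x) \<in> Lp_fun p M"
      using p by (intro Lp_fun_mono_AE[OF meas Lp_seminorm_const(1)[OF p M0 Mfin, of c]])
        (auto elim: eventually_mono)
    with eq show "\<exists>f\<in>Lp_fun p M. AE x in N. g x * f x = y x"
      by (intro bexI[of _ "\<lambda>x. y x / g x"])
  qed
qed

theorem isometric_surjective_iff:
  "isometric \<and> surjective \<longleftrightarrow>
    (AE x in N. 0 < \<rho> x) \<and>
    (AE x in N. cmod (g x * complex_of_real (\<rho> x powr (- recip p))) =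
      (if p = q then 1 else measure N (space N) powr (recip p - recip q))) \<and>
    (p \<noteq> q \<and> emeasure N (space N) \<noteq> 0 \<longrightarrow> single_atom_space M)" (is "?I \<longleftrightarrow> ?C")
proof (cases "emeasure N (space N) = 0")
  case True
  \<comment> \<open>Both spaces are zero, and every condition holds trivially.\<close>
  then have AE: "AE x in N. P x" for P
    by (intro AE_I[of _ _ "space N"]) auto
  have AE': "AE x in M. P x" for P
    using AE by (simp add: AE_M_iff)
  have isometric
    using Lp_seminorm_eq_0_iff[OF mult_well_definedD[OF well_defined] q] Lp_seminorm_eq_0_iff[OF _ p, of _ M] AE AE'
    by (auto simp: isometric_def)
  moreover have surjective
    using AE zero_in_Lp_fun by (auto simp: surjective_def)
  ultimately show ?thesis using AE True by simp
next
  case False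
  let ?K = "if p = q then 1 else measure N (space N) powr (recip p - recip q)"
  have mod_iff: "(AE x in N. cmod (g x * complex_of_real (\<rho> x powr (- recip p))) = ?K) \<longleftrightarrow>
      (AE x in N. cmod (g x) = ?K * \<rho> x powr recip p)" if "AE x in N. 0 < \<rho> x"
  proof (rule eventually_subst)
    show "AE x in N. (cmod (g x * complex_of_real (\<rho> x powr (- recip p))) = ?K) \<longleftrightarrow>
        (cmod (g x) = ?K * \<rho> x powr recip p)"
      using that by eventually_elim (rule cmod_mult_powr_uminus_iff)
  qed
  show ?thesis
  proof
    assume I: ?I
    then have pos: "AE x in N. 0 < \<rho> x"
      using nonzero_imp_density_pos surjective_imp_nonzero by blast
    show ?C
    proof (cases "p = q")
      case True
      have "AE x in N. cmod (g x) = \<rho> x powr recip p"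
      proof (cases "p = \<infinity>")
        case True
        with I \<open>p = q\<close> have "AE x in N. cmod (g x) = 1"
          by (intro isometric_same_exponent_infinite pos) auto
        with pos show ?thesis
          by eventually_elim (use True in auto)
      qed (use I True pos isometric_same_exponent_finite in auto)
      then show ?thesis using True pos mod_iff[OF pos] by simp
    next
      case pq: False
      have "emeasure M (space M) \<noteq> 0"
        using False AE_M_iff_AE_N[OF pos, of "\<lambda>_. False"]
        by (simp add: AE_iff_measurable[OF sets.top])
      then have atom: "single_atom_space M"
        using I pq isometric_imp_single_atom by blast
      then show ?thesis
        using pq pos mod_iff[OF pos] isometric_imp_atom_modulus[OF _ atom pos] I by simp
    qed
  next
    assume C: ?C
    then have pos: "AE x in N. 0 < \<rho> x" by blast
    then have mod: "AE x in N. cmod (g x) = ?K * \<rho> x powr recip p"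
      using C mod_iff by blast
    show ?I
    proof (cases "p = q")
      case True
      then show ?thesis using same_exponent_modulus_imp_isometry[OF True pos] mod by simp
    next
      case pq: False
      then have "single_atom_space M" using C False by blast
      then show ?thesis using atom_modulus_imp_isometry[OF _ pos] mod pq by simp
    qed
  qed
qed

end

section \<open>Restriction to a set on which the target measure is concentrated\<close>

lemma indicator_mult_in_Lp_fun:
  assumes "A \<in> sets M" "f \<in> Lp_fun p M" "1 \<le> p"
  shows "(\<lambda>x. indicator A x * f x) \<in> Lp_fun p M"
proof -
  have [measurable]: "f \<in> borel_measurable M" "A \<in> sets M" using assms by (auto simp: Lp_fun_measurable)
  show ?thesis
    using assms by (intro Lp_fun_mono_AE[OF _ assms(2)]) (auto simp: indicator_def)
qed

lemma Lp_fun_imp_Lp_fun_restrict_space: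
  assumes "A \<in> sets M" "f \<in> Lp_fun p M" "1 \<le> p"
  shows "f \<in> Lp_fun p (restrict_space M A)"
  using indicator_mult_in_Lp_fun[OF assms] Lp_fun_restrict_space_iff[OF assms(1,3)] by blast

lemma Lp_seminorm_restrict_space_le:
  assumes "A \<in> sets M" "f \<in> Lp_fun p M" "1 \<le> p"
  shows "Lp_seminorm p (restrict_space M A) f \<le> Lp_seminorm p M f"
  using Lp_seminorm_restrict_space[OF assms(1,3) Lp_fun_imp_Lp_fun_restrict_space[OF assms]] assms
    Lp_fun_measurable[OF indicator_mult_in_Lp_fun[OF assms]]
  by (auto intro!: Lp_seminorm_mono_AE simp: indicator_def)

lemma Lp_seminorm_restrict_space_conull:
  assumes "A \<in> sets M" "f \<in> Lp_fun p M" "1 \<le> p" and conull: "AE x in M. x \<in> A"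
  shows "Lp_seminorm p (restrict_space M A) f = Lp_seminorm p M f"
proof -
  have "AE x in M. cmod (indicator A x * f x) = cmod (f x)"
    using conull by eventually_elim simp
  then have "Lp_seminorm p M (\<lambda>x. indicator A x * f x) = Lp_seminorm p M f"
    by (rule Lp_seminorm_cong_AE[OF Lp_fun_measurable[OF indicator_mult_in_Lp_fun[OF assms(1-3)]]
        Lp_fun_measurable[OF assms(2)] _ assms(3)])
  then show ?thesis
    using Lp_seminorm_restrict_space[OF assms(1,3) Lp_fun_imp_Lp_fun_restrict_space[OF assms(1-3)]] by simp
qed

lemma mult_well_defined_restrict_space:
  assumes A: "A \<in> sets M" "A \<in> sets N" and p: "1 \<le> p" "1 \<le> q" and g: "mult_well_defined p M q N g"
  shows "mult_well_defined p (restrict_space M A) q (restrict_space N A) g"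
proof -
  have AM: "A \<inter> space M \<in> sets M" and AN: "A \<inter> space N \<in> sets N" using A by auto
  have swap: "(\<lambda>x. indicator A x * (g x * f x)) = (\<lambda>x. g x * (indicator A x * f x))" for f :: "'a \<Rightarrow> complex"
    by (auto simp: mult_ac)
  have "(\<lambda>x. g x * f x) \<in> Lp_fun q (restrict_space N A)" if "f \<in> Lp_fun p (restrict_space M A)" for f
    using that g unfolding Lp_fun_restrict_space_iff[OF A(1) p(1)] Lp_fun_restrict_space_iff[OF A(2) p(2)] swap
    by (rule mult_well_definedD[rotated])
  moreover have "AE x in restrict_space N A. g x * f x = g x * f' x"
    if "f \<in> Lp_fun p (restrict_space M A)" "f' \<in> Lp_fun p (restrict_space M A)"
      and eq: "AE x in restrict_space M A. f x = f' x" for f f'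
  proof -
    have "AE x in M. indicator A x * f x = indicator A x * f' x"
      using eq unfolding AE_restrict_space_iff[OF AM] by eventually_elim (auto simp: indicator_def)
    then have "AE x in N. g x * (indicator A x * f x) = g x * (indicator A x * f' x)"
      using that(1,2) g[unfolded mult_well_defined_def, THEN conjunct2, rule_format,
          of "\<lambda>x. indicator A x * f x" "\<lambda>x. indicator A x * f' x"]
      unfolding Lp_fun_restrict_space_iff[OF A(1) p(1)] by simp
    then show ?thesis
      unfolding AE_restrict_space_iff[OF AN] by eventually_elim (auto simp: indicator_def)
  qed
  ultimately show ?thesis by (auto simp: mult_well_defined_def)
qed

text \<open>
  The singular part \<open>Ms\<close> lives on \<open>\<Omega>s\<close>, so only the density is seen on the complement.
\<close>
lemma lebesgue_decomposition_restrict_space: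
  assumes dec: "lebesgue_decomposition M N \<rho> Ms \<Omega>s" and sets: "sets N = sets M"
  shows "restrict_space M (space M - \<Omega>s) = density (restrict_space N (space M - \<Omega>s)) (\<lambda>x. ennreal (\<rho> x))"
proof (rule measure_eqI)
  let ?A = "space M - \<Omega>s"
  have [measurable]: "\<rho> \<in> borel_measurable N" and S: "\<Omega>s \<in> sets M" and Ms: "sets Ms = sets M" "emeasure Ms ?A = 0"
    and split: "\<And>E. E \<in> sets M \<Longrightarrow> emeasure M E = emeasure (density N (\<lambda>x. ennreal (\<rho> x))) E + emeasure Ms E"
    using dec by (auto simp: lebesgue_decomposition_def)
  have A: "?A \<in> sets M" "?A \<in> sets N" using S sets by auto
  have AN: "?A \<inter> space N \<in> sets N" using A by auto
  show "sets (restrict_space M ?A) = sets (density (restrict_space N ?A) (\<lambda>x. ennreal (\<rho> x)))"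
    by (simp add: sets_restrict_space_cong[OF sets[symmetric]])
  fix E assume "E \<in> sets (restrict_space M ?A)"
  then have E: "E \<in> sets M" "E \<subseteq> ?A" "E \<in> sets (restrict_space N ?A)"
    using A sets by (auto simp: sets_restrict_space_iff sets_restrict_space_cong[OF sets[symmetric]])
  have [measurable]: "E \<in> sets N" using E sets by simp
  have "emeasure Ms E = 0"
    using Ms E A by (metis emeasure_eq_0)
  then have "emeasure (restrict_space M ?A) E = (\<integral>\<^sup>+x. ennreal (\<rho> x) * indicator E x \<partial>N)"
    using E A split[OF E(1)] by (simp add: emeasure_restrict_space emeasure_density)
  also have "\<dots> = (\<integral>\<^sup>+x. ennreal (\<rho> x) * indicator E x * indicator ?A x \<partial>N)"
    using E by (intro nn_integral_cong) (auto simp: indicator_def)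
  also have "\<dots> = emeasure (density (restrict_space N ?A) (\<lambda>x. ennreal (\<rho> x))) E"
    using E(3) by (simp add: emeasure_density nn_integral_restrict_space[OF AN] measurable_restrict_space1)
  finally show "emeasure (restrict_space M ?A) E = emeasure (density (restrict_space N ?A) (\<lambda>x. ennreal (\<rho> x))) E" .
qed

text \<open>
  Functions in \<open>L_q(N)\<close> are determined by their values on \<open>A\<close>, and cutting a preimage down to \<open>A\<close> does not increase
  its norm. The restricted operator is thus a coisometry as well. It is moreover injective, because
  surjectivity forces \<open>g\<close> to vanish almost nowhere, and an injective coisometry is isometric: the
  preimage of almost minimal norm is the only preimage. Conversely, extension by zero turns the
  inverse of the restricted isometry into a norm-preserving lift.
\<close>
lemma coisometric_iff_restriction_isometric:
  assumes A: "A \<in> sets M" "A \<in> sets N" and conull: "AE x in N. x \<in> A"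
    and dm: "density_multiplication (restrict_space M A) (restrict_space N A) p q g \<rho>"
    and wd: "mult_well_defined p M q N g"
  shows "coisometric (Lp p M) (Lp q N) (mult_op q N g) \<longleftrightarrow>
    isometric_isomorphism (Lp p (restrict_space M A)) (Lp q (restrict_space N A)) (mult_op q (restrict_space N A) g)"
proof -
  let ?M = "restrict_space M A" and ?N = "restrict_space N A"
  interpret density_multiplication ?M ?N p q g \<rho> by (rule dm)
  have AM: "A \<inter> space M \<in> sets M" and AN: "A \<inter> space N \<in> sets N" using A by auto
  have AE_N: "(AE x in ?N. P x) \<longleftrightarrow> (AE x in N. P x)" for P
    unfolding AE_restrict_space_iff[OF AN] using conull by (auto elim: eventually_elim2)
  let ?ext = "\<lambda>f x. indicator A x * f x :: complex"
  have ext: "?ext f \<in> Lp_fun p M" "Lp_seminorm p M (?ext f) = Lp_seminorm p ?M f"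
    if "f \<in> Lp_fun p ?M" for f
    using that Lp_fun_restrict_space_iff[OF A(1) p] Lp_seminorm_restrict_space[OF A(1) p] by auto
  have ext_eq: "AE x in N. g x * ?ext f x = g x * f x" for f
    using conull by eventually_elim simp
  have norm_ext: "Lp_seminorm q N (\<lambda>x. g x * ?ext f x) = Lp_seminorm q ?N (\<lambda>x. g x * f x)"
    if f: "f \<in> Lp_fun p ?M" for f
  proof -
    have L: "(\<lambda>x. g x * ?ext f x) \<in> Lp_fun q N" using ext(1)[OF f] by (rule mult_well_definedD[OF wd])
    have "Lp_seminorm q ?N (\<lambda>x. g x * f x) = Lp_seminorm q ?N (\<lambda>x. g x * ?ext f x)"
      using ext_eq[of f] q
      by (intro Lp_seminorm_cong_AE Lp_fun_measurable[OF mult_well_definedD[OF well_defined f]]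
          Lp_fun_measurable[OF Lp_fun_imp_Lp_fun_restrict_space[OF A(2) L q]])
        (auto simp: AE_N elim!: eventually_mono)
    also have "\<dots> = Lp_seminorm q N (\<lambda>x. g x * ?ext f x)"
      by (rule Lp_seminorm_restrict_space_conull[OF A(2) L q conull])
    finally show ?thesis by simp
  qed
  have "coisometric (Lp p M) (Lp q N) (mult_op q N g) \<longleftrightarrow> isometric \<and> surjective"
    unfolding coisometric_mult_op_iff[OF wd p q]
  proof (intro iffI conjI)
    assume C: "(\<forall>f\<in>Lp_fun p M. Lp_seminorm q N (\<lambda>x. g x * f x) \<le> Lp_seminorm p M f) \<and>
      (\<forall>c'>1. \<forall>y\<in>Lp_fun q N. \<exists>f\<in>Lp_fun p M. (AE x in N. g x * f x = y x) \<and>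
       (if AE x in N. y x = 0 then AE x in M. f x = 0
        else Lp_seminorm p M f < c' * Lp_seminorm q N y))"
    then have contr: "\<And>f. f \<in> Lp_fun p M \<Longrightarrow> Lp_seminorm q N (\<lambda>x. g x * f x) \<le> Lp_seminorm p M f"
      and lift: "\<And>c' y. 1 < c' \<Longrightarrow> y \<in> Lp_fun q N \<Longrightarrow> \<exists>f\<in>Lp_fun p M. (AE x in N. g x * f x = y x) \<and>
       (if AE x in N. y x = 0 then AE x in M. f x = 0
        else Lp_seminorm p M f < c' * Lp_seminorm q N y)"
      by blast+
    show surj: surjective
      unfolding surjective_def
    proof
      fix y assume "y \<in> Lp_fun q ?N"
      then have "?ext y \<in> Lp_fun q N" using Lp_fun_restrict_space_iff[OF A(2) q] by blast
      then obtain f where f: "f \<in> Lp_fun p M" "AE x in N. g x * f x = ?ext y x"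
        using lift[of 2 "?ext y"] by auto
      have "AE x in ?N. g x * f x = y x"
        unfolding AE_N using f(2) conull by eventually_elim simp
      then show "\<exists>f\<in>Lp_fun p ?M. AE x in ?N. g x * f x = y x"
        using Lp_fun_imp_Lp_fun_restrict_space[OF A(1) f(1) p] by blast
    qed
    \<comment> \<open>Injectivity of the restricted operator.\<close>
    have g0: "AE x in ?N. g x \<noteq> 0" by (rule surjective_imp_nonzero[OF surj])
    show isometric
      unfolding isometric_def
    proof (intro ballI antisym)
      fix f assume f: "f \<in> Lp_fun p ?M"
      show "Lp_seminorm q ?N (\<lambda>x. g x * f x) \<le> Lp_seminorm p ?M f"
        using contr[OF ext(1)[OF f]] by (simp add: norm_ext[OF f] ext(2)[OF f])
      let ?y = "\<lambda>x. g x * ?ext f x"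
      have y: "?y \<in> Lp_fun q N" using ext(1)[OF f] by (rule mult_well_definedD[OF wd])
      have *: "Lp_seminorm p ?M f \<le> c' * Lp_seminorm q N ?y" if c': "1 < c'" for c'
      proof -
        obtain f' where f': "f' \<in> Lp_fun p M" "AE x in N. g x * f' x = ?y x"
          "if AE x in N. ?y x = 0 then AE x in M. f' x = 0
            else Lp_seminorm p M f' < c' * Lp_seminorm q N ?y"
          using lift[OF c' y] by blast
        have "AE x in ?N. f' x = f x"
          using g0 f'(2) conull unfolding AE_N by eventually_elim simp
        then have eq: "AE x in ?M. f' x = f x"
          unfolding AE_M_iff by (auto elim: eventually_mono)
        have "Lp_seminorm p ?M f = Lp_seminorm p ?M f'"
          using eq p by (intro Lp_seminorm_cong_AE Lp_fun_measurable[OF f]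
            Lp_fun_measurable[OF Lp_fun_imp_Lp_fun_restrict_space[OF A(1) f'(1) p]])
            (auto elim!: eventually_mono)
        also have "\<dots> \<le> Lp_seminorm p M f'"
          by (rule Lp_seminorm_restrict_space_le[OF A(1) f'(1) p])
        also have "\<dots> \<le> c' * Lp_seminorm q N ?y"
          using f'(3) c' Lp_seminorm_eq_0_iff[OF f'(1) p] Lp_seminorm_nonneg[of q N ?y]
          by (auto split: if_splits)
        finally show ?thesis .
      qed
      \<comment> \<open>The bound holds for every constant above \<open>1\<close>, so it survives the limit \<open>c' \<rightarrow> 1\<close>.\<close>
      have "Lp_seminorm p ?M f \<le> 1 * Lp_seminorm q N ?y"
      proof (rule tendsto_lowerbound)
        show "((\<lambda>c'. c' * Lp_seminorm q N ?y) \<longlongrightarrow> 1 * Lp_seminorm q N ?y) (at_right 1)"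
          by (intro tendsto_intros)
        show "eventually (\<lambda>c'. Lp_seminorm p ?M f \<le> c' * Lp_seminorm q N ?y) (at_right 1)"
          using * by (auto simp: eventually_at_right_field intro!: exI[of _ 2])
      qed simp
      then show "Lp_seminorm p ?M f \<le> Lp_seminorm q ?N (\<lambda>x. g x * f x)"
        by (simp add: norm_ext[OF f])
    qed
  next
    assume I: "isometric \<and> surjective"
    show "\<forall>f\<in>Lp_fun p M. Lp_seminorm q N (\<lambda>x. g x * f x) \<le> Lp_seminorm p M f"
    proof
      fix f assume f: "f \<in> Lp_fun p M"
      have f': "f \<in> Lp_fun p ?M" by (rule Lp_fun_imp_Lp_fun_restrict_space[OF A(1) f p])
      have "Lp_seminorm q N (\<lambda>x. g x * f x) = Lp_seminorm q ?N (\<lambda>x. g x * f x)"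
        using Lp_seminorm_restrict_space_conull[OF A(2) mult_well_definedD[OF wd f] q conull] by simp
      also have "\<dots> = Lp_seminorm p ?M f"
        using I f' by (simp add: isometric_def)
      also have "\<dots> \<le> Lp_seminorm p M f"
        by (rule Lp_seminorm_restrict_space_le[OF A(1) f p])
      finally show "Lp_seminorm q N (\<lambda>x. g x * f x) \<le> Lp_seminorm p M f" .
    qed
    show "\<forall>c'>1. \<forall>y\<in>Lp_fun q N. \<exists>f\<in>Lp_fun p M. (AE x in N. g x * f x = y x) \<and>
       (if AE x in N. y x = 0 then AE x in M. f x = 0
        else Lp_seminorm p M f < c' * Lp_seminorm q N y)"
    proof (intro allI impI ballI)
      fix c' :: real and y assume c': "1 < c'" and y: "y \<in> Lp_fun q N"
      show "\<exists>f\<in>Lp_fun p M. (AE x in N. g x * f x = y x) \<and>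
       (if AE x in N. y x = 0 then AE x in M. f x = 0
        else Lp_seminorm p M f < c' * Lp_seminorm q N y)"
      proof (cases "AE x in N. y x = 0")
        case True
        then show ?thesis
          by (intro bexI[of _ "\<lambda>_. 0"]) (auto simp: zero_in_Lp_fun elim: eventually_mono)
      next
        case False
        have y': "y \<in> Lp_fun q ?N" by (rule Lp_fun_imp_Lp_fun_restrict_space[OF A(2) y q])
        then obtain f where f: "f \<in> Lp_fun p ?M" "AE x in ?N. g x * f x = y x"
          using I by (auto simp: surjective_def)
        have "AE x in N. g x * ?ext f x = y x"
          using f(2) ext_eq[of f] unfolding AE_N by eventually_elim simp
        moreover have "Lp_seminorm p M (?ext f) < c' * Lp_seminorm q N y"
        proof -
          have "Lp_seminorm p M (?ext f) = Lp_seminorm q ?N (\<lambda>x. g x * f x)"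
            using I f(1) by (simp add: ext isometric_def)
          also have "\<dots> = Lp_seminorm q ?N y"
            using f(2) q Lp_fun_measurable[OF mult_well_definedD[OF well_defined f(1)]] Lp_fun_measurable[OF y']
            by (intro Lp_seminorm_cong_AE) (auto elim: eventually_mono)
          also have "\<dots> = Lp_seminorm q N y"
            by (rule Lp_seminorm_restrict_space_conull[OF A(2) y q conull])
          finally show ?thesis
            using c' False Lp_seminorm_eq_0_iff[OF y q] Lp_seminorm_nonneg[of q N y] by simp
        qed
        ultimately show ?thesis
          using False ext(1)[OF f(1)] by (intro bexI[of _ "?ext f"]) auto
      qed
    qed
  qed
  also have "\<dots> \<longleftrightarrow> isometric_isomorphism (Lp p ?M) (Lp q ?N) (mult_op q ?N g)"
    by (simp add: isometric_isomorphism_mult_op_iff[OF well_defined p q] isometric_def surjective_def)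
  finally show ?thesis .
qed

section \<open>Coisometric multiplication operators\<close>

theorem theorem2p4p3:
  fixes M N Ms :: "'a measure" and p q :: ennreal
    and g :: "'a \<Rightarrow> complex" and \<rho> :: "'a \<Rightarrow> real" and \<Omega>s \<Omega>c :: "'a set"
  assumes "sigma_finite_measure M" and "sigma_finite_measure N" and "sets N = sets M"
    and "1 \<le> p" and "1 \<le> q"
    and "g \<in> borel_measurable M"
    and "mult_well_defined p M q N g"
    and "bounded_operator (Lp p M) (Lp q N) (mult_op q N g)"
    and "lebesgue_decomposition M N \<rho> Ms \<Omega>s"
    and "\<Omega>c = space M - \<Omega>s"
  shows "(coisometric (Lp p M) (Lp q N) (mult_op q N g) \<longleftrightarrow>
          isometric_isomorphism (Lp p (restrict_space M \<Omega>c)) (Lp q (restrict_space N \<Omega>c))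
            (mult_op q (restrict_space N \<Omega>c) g)) \<and>
         (coisometric (Lp p M) (Lp q N) (mult_op q N g) \<longleftrightarrow>
          (AE x in N. 0 < \<rho> x) \<and>
          (AE x in restrict_space N \<Omega>c.
             cmod (g x * complex_of_real (\<rho> x powr (- recip p))) =
               (if p = q then 1 else measure N \<Omega>c powr (recip p - recip q))) \<and>
          (p \<noteq> q \<and> emeasure N (space N) \<noteq> 0 \<longrightarrow> single_atom_space (restrict_space M \<Omega>c)))"
proof -
  have S: "\<Omega>s \<in> sets M" and \<rho>: "\<rho> \<in> borel_measurable N" and null: "emeasure N \<Omega>s = 0"
    using assms(9) by (auto simp: lebesgue_decomposition_def)
  have sp: "space N = space M" by (rule sets_eq_imp_space_eq[OF assms(3)])
  have A: "\<Omega>c \<in> sets M" "\<Omega>c \<in> sets N" using S assms(3,10) by auto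
  have AN: "\<Omega>c \<inter> space N \<in> sets N" using A by auto
  have "AE x in N. x \<notin> \<Omega>s"
    using S null assms(3) by (intro AE_not_in) (auto simp: null_sets_def)
  then have conull: "AE x in N. x \<in> \<Omega>c"
    using AE_space by eventually_elim (simp add: assms(10) sp)
  have AE_N: "(AE x in restrict_space N \<Omega>c. P x) \<longleftrightarrow> (AE x in N. P x)" for P
    unfolding AE_restrict_space_iff[OF AN] using conull by (auto elim: eventually_elim2)
  have emN: "emeasure N \<Omega>c = emeasure N (space N)"
    using conull A by (intro emeasure_eq_AE) (auto elim!: eventually_mono)
  have spN: "space (restrict_space N \<Omega>c) = \<Omega>c"
    using A sets.sets_into_space by (auto simp: space_restrict_space)
  have emN': "emeasure (restrict_space N \<Omega>c) \<Omega>c = emeasure N \<Omega>c"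
    using A by (simp add: emeasure_restrict_space)
  have dm: "density_multiplication (restrict_space M \<Omega>c) (restrict_space N \<Omega>c) p q g \<rho>"
  proof (rule density_multiplication.intro)
    show "g \<in> borel_measurable (restrict_space N \<Omega>c)"
      using assms(6) by (intro measurable_restrict_space1) (simp add: measurable_cong_sets[OF assms(3) refl])
    show "restrict_space M \<Omega>c = density (restrict_space N \<Omega>c) (\<lambda>x. ennreal (\<rho> x))"
      unfolding assms(10) by (rule lebesgue_decomposition_restrict_space[OF assms(9,3)])
    show "\<rho> \<in> borel_measurable (restrict_space N \<Omega>c)"
      using \<rho> by (rule measurable_restrict_space1)
    show "mult_well_defined p (restrict_space M \<Omega>c) q (restrict_space N \<Omega>c) g"
      by (rule mult_well_defined_restrict_space[OF A assms(4,5,7)])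
  qed (intro sigma_finite_measure_restrict_space assms(1,2,4,5) A)+
  interpret density_multiplication "restrict_space M \<Omega>c" "restrict_space N \<Omega>c" p q g \<rho> by (rule dm)
  have iso: "isometric_isomorphism (Lp p (restrict_space M \<Omega>c)) (Lp q (restrict_space N \<Omega>c))
      (mult_op q (restrict_space N \<Omega>c) g) \<longleftrightarrow> isometric \<and> surjective"
    by (simp add: isometric_isomorphism_mult_op_iff[OF well_defined p q] isometric_def surjective_def)
  have coiso: "coisometric (Lp p M) (Lp q N) (mult_op q N g) \<longleftrightarrow>
      isometric_isomorphism (Lp p (restrict_space M \<Omega>c)) (Lp q (restrict_space N \<Omega>c))
        (mult_op q (restrict_space N \<Omega>c) g)"
    by (rule coisometric_iff_restriction_isometric[OF A conull dm assms(7)])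
  have meas: "measure (restrict_space N \<Omega>c) \<Omega>c = measure N \<Omega>c"
    using emN' by (simp add: measure_def)
  show ?thesis
    using coiso isometric_surjective_iff[unfolded spN meas emN' emN AE_N] unfolding iso AE_N by blast
qed

end
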